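(* Let $1<p<\infty$ and $n\ge1$. There is a constant $c>0$ depending only on $n$ and $p$ such that for every weight $w\in A_p^{(s)}(\mathbb{R}^n)$ and every $f\in L^p_w(\mathbb{R}^n)$, $$\|M^{(s)}f\|_{L^{p}_{w}(\mathbb{R}^n)}\le c\Big(\prod_{i=1}^{n}\|w\|_{A_p(x_{i})}\Big)^{1/(p-1)}\|f\|_{L^{p}_{w}(\mathbb{R}^n)}.$$ Further, the power $1/(p-1)$ is sharp: there is no positive non-decreasing function $\psi$ on $[1,\infty)$ with $\psi(t)/t^{1/(p-1)}\to0$ as $t\to\infty$ such that $\|M^{(s)}f\|_{L^{p}_{w}(\mathbb{R}^n)}\le\psi\big(\prod_{i=1}^{n}\|w\|_{A_p(x_{i})}\big)\|f\|_{L^{p}_{w}(\mathbb{R}^n)}$ for all $w\in A_p^{(s)}(\mathbb{R}^n)$ and all $f\in L^p_w(\mathbb{R}^n)$.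
   Context: A weight is an a.e. positive locally integrable function. $p'=p/(p-1)$; $\|f\|_{L^p_w(\mathbb{R}^n)}=\big(\int_{\mathbb{R}^n}|f|^p w\,dx\big)^{1/p}$. The strong Hardy--Littlewood maximal operator is $M^{(s)}f(x)=\sup_{P\ni x}\frac1{|P|}\int_P|f(y)|dy$, the supremum being over all (bounded) parallelepipeds $P\subset\mathbb{R}^n$ with sides parallel to the coordinate axes that contain $x$. The weight $w$ belongs to $A_p^{(s)}(\mathbb{R}^n)$ if $$\sup_P\Big(\frac1{|P|}\int_P w\,dx\Big)\Big(\frac1{|P|}\int_P w^{1-p'}dx\Big)^{p-1}<\infty,$$ the supremum being over the same family of parallelepipeds. The $A_p$ characteristic in the variable $x_i$, uniform with respect to the other variables, is $$\|w\|_{A_p(x_i)}=\operatorname*{ess\,sup}_{(x_1,\dots,x_{i-1},x_{i+1},\dots,x_n)\in\mathbb{R}^{n-1}}\ \sup_I\Big(\frac1{|I|}\int_I w(x_1,\dots,x_n)\,dx_i\Big)\Big(\frac1{|I|}\int_I w^{1-p'}(x_1,\dots,x_n)\,dx_i\Big)^{p-1},$$ where $I$ runs over bounded intervals of $\mathbb{R}$. It is known that $w\in A_p^{(s)}(\mathbb{R}^n)$ if and only if $\|w\|_{A_p(x_i)}<\infty$ for all $i=1,\dots,n$. *)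

theory Defs
  imports "HOL-Analysis.Analysis" "HOL-Probability.Essential_Supremum"
begin

text \<open>
  All averages, norms and characteristics take values in \<open>[0, \<infinity>]\<close>, i.e. in \<^typ>\<open>ennreal\<close>, so that
  no finiteness is presupposed. Measurability is Lebesgue measurability throughout.
\<close>

text \<open>The power \<open>x\<^sup>a\<close> on \<open>[0, \<infinity>]\<close>; it is only used for exponents \<open>a > 0\<close>.\<close>

definition epowr :: "ennreal \<Rightarrow> real \<Rightarrow> ennreal" where
  "epowr x a = (if x = top then top else ennreal (enn2real x powr a))"

definition conj_exp :: "real \<Rightarrow> real" where
  "conj_exp p = p / (p - 1)"

text \<open>
  Bounded axis-parallel boxes with nonempty interior; in dimension one these are the compact
  intervals of positive length. Suprema of averages over closed boxes (containing a given point)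
  agree with those over all products of bounded nondegenerate intervals, since a box and its
  closure have the same averages.
\<close>

definition parallelepipeds :: "'a::euclidean_space set set" where
  "parallelepipeds = {cbox a b | a b. box a b \<noteq> {}}"

definition avg :: "'a::euclidean_space set \<Rightarrow> ('a \<Rightarrow> ennreal) \<Rightarrow> ennreal" where
  "avg P g = (\<integral>\<^sup>+x\<in>P. g x \<partial>lebesgue) / emeasure lebesgue P"

definition weight :: "('a::euclidean_space \<Rightarrow> real) \<Rightarrow> bool" where
  "weight w \<longleftrightarrow>
     (AE x in lebesgue. 0 < w x) \<and> (\<forall>K. compact K \<longrightarrow> set_integrable lebesgue K w)"

definition lpw_norm :: "real \<Rightarrow> ('a::euclidean_space \<Rightarrow> real) \<Rightarrow> ('a \<Rightarrow> ennreal) \<Rightarrow> ennreal" where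
  "lpw_norm p w g = epowr (\<integral>\<^sup>+x. epowr (g x) p * ennreal (w x) \<partial>lebesgue) (1 / p)"

definition Lpw :: "real \<Rightarrow> ('a::euclidean_space \<Rightarrow> real) \<Rightarrow> ('a \<Rightarrow> real) set" where
  "Lpw p w = {f \<in> borel_measurable lebesgue. lpw_norm p w (\<lambda>x. ennreal \<bar>f x\<bar>) < \<infinity>}"

definition strong_maximal :: "('a::euclidean_space \<Rightarrow> real) \<Rightarrow> 'a \<Rightarrow> ennreal" where
  "strong_maximal f x = (SUP P\<in>{P \<in> parallelepipeds. x \<in> P}. avg P (\<lambda>y. ennreal \<bar>f y\<bar>))"

definition Ap_const :: "real \<Rightarrow> ('a::euclidean_space \<Rightarrow> real) \<Rightarrow> ennreal" where
  "Ap_const p w = (SUP P\<in>parallelepipeds.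
     avg P (\<lambda>x. ennreal (w x)) *
     epowr (avg P (\<lambda>x. ennreal (w x powr (1 - conj_exp p)))) (p - 1))"

definition Ap_strong :: "real \<Rightarrow> ('a::euclidean_space \<Rightarrow> real) set" where
  "Ap_strong p = {w. weight w \<and> Ap_const p w < \<infinity>}"

text \<open>
  The remaining \<open>n - 1\<close> variables range over functions on \<^term>\<open>UNIV - {i}\<close>. The product measure is
  completed because \<^const>\<open>esssup\<close> is \<open>\<infinity>\<close> by convention for nonmeasurable functions, whereas the
  slicewise characteristic of a Lebesgue measurable weight need only be measurable up to null sets.
\<close>

definition Ap_char_var :: "real \<Rightarrow> (real^'n::finite \<Rightarrow> real) \<Rightarrow> 'n \<Rightarrow> ennreal" where
  "Ap_char_var p w i =
     esssup (completion (Pi\<^sub>M (UNIV - {i}) (\<lambda>_. lborel :: real measure)))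
       (\<lambda>y. Ap_const p (\<lambda>t::real. w (\<chi> j. if j = i then t else y j)))"

definition Ap_char_prod :: "real \<Rightarrow> (real^'n::finite \<Rightarrow> real) \<Rightarrow> ennreal" where
  "Ap_char_prod p w = (\<Prod>i\<in>UNIV. Ap_char_var p w i)"

end

(*
  The strong maximal function is dominated by the composition of the one-dimensional maximal
  functions in the n coordinate directions, so by Fubini the upper bound reduces to Buckley's bound
  ||M|| <= c A^(1/(p-1)) on the line, applied to the slices of w. That bound follows from Lerner's
  pointwise estimate
    (M f)^(p-1) <= A M_w (M_sigma (f/sigma)^(p-1) / w),    sigma = w^(1-p'),
  because the uncentred maximal functions M_w and M_sigma with respect to a measure on the line are
  bounded on L^q with norm independent of the measure: a finite family of intervals has a subfamily
  with the same union and overlap at most two, which gives the weak type (1,1) inequality, and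
  truncating at half the level gives the strong one. Averages over intervals with rational endpoints
  suffice at the cost of a factor 2 in each variable, and make every function measurable.

  For the sharpness, w(x) = |x_k|^((p-1)(1-d)) has characteristic of order d^(1-p) in x_k and 1 in the
  other variables, while f(x) = x_k^(d-1) on the unit cube satisfies M f >= f/d.
*)
theory Submission
  imports Defs "HOL-Real_Asymp.Real_Asymp"
begin

subsection \<open>Powers of extended nonnegative reals\<close>

text \<open>Measurability and positivity shape the proof. Slices of a Lebesgue measurable function
  need not be measurable, and a weight is positive only almost everywhere. So \<open>w\<close> and
  \<open>\<bar>f\<bar>\<close> are replaced by Borel versions, the first one positive everywhere;
  averages do not see the change, and almost every slice of the weight keeps its characteristic.
  Moreover, directional maximal functions can be composed only if each of them returns a Borel
  function on the whole space, which is why countably many intervals are used. The bounds for M_w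
  and M_sigma must not depend on the measure: a doubling constant would itself depend on A and bring
  in further powers of it. On the line the order alone controls the overlap of intervals, so A
  enters only through the pointwise estimate. In the sharpness part, \<open>d\<close> measures how
  far the exponent of the dual weight is from the critical value -1, and f is that dual weight cut
  off to the cube. Both the gain of M on f and the characteristic to the power 1/(p-1) are of order
  1/d.\<close>

lemma epowr_ennreal: "0 \<le> r \<Longrightarrow> epowr (ennreal r) a = ennreal (r powr a)"
  by (simp add: epowr_def)

lemma epowr_top [simp]: "epowr top a = top"
  by (simp add: epowr_def)

lemma epowr_0 [simp]: "epowr 0 a = 0"
  by (simp add: epowr_def)

lemma epowr_1 [simp]: "epowr x 1 = x"
  by (cases x) (auto simp: epowr_ennreal)

lemma epowr_eq_0_iff: "epowr x a = 0 \<longleftrightarrow> x = 0"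
  by (cases x) (auto simp: epowr_ennreal)

lemma epowr_mono: "x \<le> y \<Longrightarrow> 0 \<le> a \<Longrightarrow> epowr x a \<le> epowr y a"
  by (cases x; cases y) (auto simp: epowr_ennreal top_unique intro!: powr_mono2 ennreal_leI)

lemma epowr_mult: "0 < a \<Longrightarrow> epowr (x * y) a = epowr x a * epowr y a"
  by (cases x; cases y)
    (auto simp: epowr_ennreal ennreal_mult_top ennreal_top_mult powr_mult simp flip: ennreal_mult)

lemma epowr_epowr: "epowr (epowr x a) b = epowr x (a * b)"
  by (cases x) (auto simp: epowr_ennreal powr_powr)

lemma borel_measurable_epowr [measurable (raw)]:
  assumes [measurable]: "f \<in> borel_measurable M"
  shows "(\<lambda>x. epowr (f x) a) \<in> borel_measurable M"
  unfolding epowr_def by measurable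

section \<open>The layer-cake formula\<close>

lemma nn_integral_powr:
  fixes r e :: real
  assumes "0 < e" "0 \<le> r"
  shows "(\<integral>\<^sup>+t\<in>{0<..<r}. ennreal (t powr (e - 1)) \<partial>lborel) = ennreal (r powr e / e)"
proof -
  have "((\<lambda>t. t powr (e - 1)) has_integral r powr e / e) {0..r}"
    using has_integral_powr_from_0[of "e - 1" r] assms by simp
  then have "(\<integral>\<^sup>+t. ennreal (t powr (e - 1)) * indicator {0..r} t \<partial>lborel) = ennreal (r powr e / e)"
    by (intro nn_integral_has_integral_lebesgue') auto
  moreover have "AE t::real in lborel. t \<noteq> 0 \<and> t \<noteq> r"
    using AE_lborel_singleton[of 0] AE_lborel_singleton[of r] by eventually_elim simp
  then have "(\<integral>\<^sup>+t\<in>{0<..<r}. ennreal (t powr (e - 1)) \<partial>lborel)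
      = (\<integral>\<^sup>+t. ennreal (t powr (e - 1)) * indicator {0..r} t \<partial>lborel)"
    by (intro nn_integral_cong_AE, eventually_elim) (auto simp: indicator_def)
  ultimately show ?thesis by simp
qed

text \<open>\<open>x^q / q\<close> is the integral of \<open>t^(q-1)\<close> over
  \<open>0 < t < x\<close>; infinite \<open>x\<close> is included because maximal functions may be
  infinite. The range is encoded by \<open>if\<close>, since \<open>x\<close> will depend on the
  other variable of a double integral.\<close>

lemma epowr_layer_cake:
  assumes "0 < q"
  shows "(\<integral>\<^sup>+t. (if 0 < t \<and> ennreal t < x then ennreal (t powr (q - 1)) else 0) \<partial>lborel)
    = ennreal (1 / q) * epowr x q"
proof -
  have "(\<integral>\<^sup>+t. ennreal (t powr (q - 1)) * indicator {t. 0 < t \<and> ennreal t < x} t \<partial>lborel)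
    = ennreal (1 / q) * epowr x q"
  proof (cases x)
    case (real r)
    have "{t. 0 < t \<and> ennreal t < ennreal r} = {0<..<r}"
      by (auto simp: ennreal_less_iff)
    then show ?thesis
      using nn_integral_powr[OF assms, of r] real assms
      by (simp add: epowr_ennreal divide_inverse mult.commute flip: ennreal_mult)
  next
    case top
    have "ennreal (real n) \<le> (\<integral>\<^sup>+t. ennreal (t powr (q - 1)) * indicator {t::real. 0 < t} t \<partial>lborel)" for n
    proof -
      \<comment> \<open>Chosen so that the integral of \<open>t^(q-1)\<close> over
        \<open>(0, r)\<close> is exactly \<open>n\<close>; the integral over the half-line is then
        at least every natural number.\<close>
      define r where "r = (q * real n) powr (1 / q)"
      have "r powr q / q = real n" and "0 \<le> r"
        using assms by (simp_all add: r_def powr_powr)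
      then have "ennreal (real n) = (\<integral>\<^sup>+t\<in>{0<..<r}. ennreal (t powr (q - 1)) \<partial>lborel)"
        using nn_integral_powr[OF assms, of r] by simp
      also have "\<dots> \<le> (\<integral>\<^sup>+t. ennreal (t powr (q - 1)) * indicator {t::real. 0 < t} t \<partial>lborel)"
        by (intro nn_integral_mono mult_left_mono) (auto simp: indicator_def)
      finally show ?thesis .
    qed
    then have "(\<integral>\<^sup>+t. ennreal (t powr (q - 1)) * indicator {t::real. 0 < t} t \<partial>lborel) = top"
      by (metis ennreal_Ex_less_of_nat ennreal_of_nat_eq_real_of_nat infinity_ennreal_def linorder_not_le
          top.not_eq_extremum)
    then show ?thesis using top assms by (simp add: ennreal_mult_top)
  qed
  then show ?thesis
    by (auto intro!: nn_integral_cong simp: indicator_def elim!: trans[rotated])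
qed

subsection \<open>The weighted maximal function over rational intervals\<close>

text \<open>Take a subfamily of least cardinality with the same union. If three of its intervals met
  at a point, the one reaching farthest to the left and the one reaching farthest to the right would
  cover a third one, which could be dropped.\<close>

lemma minimal_interval_cover:
  fixes F :: "(real \<times> real) set"
  assumes "finite F"
  shows "\<exists>G\<subseteq>F. (\<Union>I\<in>G. {fst I..snd I}) = (\<Union>I\<in>F. {fst I..snd I})
    \<and> (\<forall>x. card {I\<in>G. x \<in> {fst I..snd I}} \<le> 2)"
proof -
  let ?U = "\<lambda>G. \<Union>I\<in>G. {fst I..snd I::real}"
  define P where "P = (\<lambda>G. G \<subseteq> F \<and> ?U G = ?U F)"
  define G where "G = arg_min card P"
  have "P F" by (simp add: P_def)
  then have PG: "P G" and min: "\<And>G'. P G' \<Longrightarrow> card G \<le> card G'"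
    unfolding G_def by (auto intro: arg_min_natI arg_min_nat_le)
  have "finite G" using PG assms by (auto simp: P_def intro: finite_subset)
  have "card {I\<in>G. x \<in> {fst I..snd I}} \<le> 2" for x
  proof (rule ccontr)
    define H where "H = {I\<in>G. x \<in> {fst I..snd I}}"
    assume "\<not> card {I\<in>G. x \<in> {fst I..snd I}} \<le> 2"
    then have card: "card H > 2" by (simp add: H_def)
    have fin: "finite H" using \<open>finite G\<close> by (rule rev_finite_subset) (auto simp: H_def)
    have ne: "H \<noteq> {}" using card by auto
    obtain I where I: "I \<in> H" "\<And>K. K \<in> H \<Longrightarrow> fst I \<le> fst K"
      using arg_min_if_finite(1)[OF fin ne, of fst] arg_min_least[OF fin ne, of _ fst] by blast
    obtain J where J: "J \<in> H" "\<And>K. K \<in> H \<Longrightarrow> snd K \<le> snd J"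
      using arg_min_if_finite(1)[OF fin ne, of "\<lambda>K. - snd K"]
        arg_min_least[OF fin ne, of _ "\<lambda>K. - snd K"] by (metis neg_le_iff_le)
    have "card {I, J} \<le> 2" by (simp add: card_insert_if)
    then have "\<not> H \<subseteq> {I, J}" using card by (meson card_mono finite.simps le_trans not_le)
    then obtain K where K: "K \<in> H" "K \<noteq> I" "K \<noteq> J" by blast
    have "{fst K..snd K} \<subseteq> {fst I..snd I} \<union> {fst J..snd J}"
      using I(1) I(2)[OF K(1)] J(1) J(2)[OF K(1)] K(1) by (auto simp: H_def)
    moreover have "I \<in> G - {K}" "J \<in> G - {K}" using I J K by (auto simp: H_def)
    ultimately have "{fst K..snd K} \<subseteq> ?U (G - {K})" by fastforce
    moreover have "?U G \<subseteq> ?U (G - {K}) \<union> {fst K..snd K}" by fastforce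
    ultimately have "?U (G - {K}) = ?U G" by blast
    then have "P (G - {K})" using PG by (auto simp: P_def)
    moreover have "card (G - {K}) < card G"
      using K(1) \<open>finite G\<close> by (intro card_Diff1_less) (auto simp: H_def)
    ultimately show False using min by (meson not_le)
  qed
  then show ?thesis using PG unfolding P_def by blast
qed

definition rat_intervals :: "(real \<times> real) set" where
  "rat_intervals = {(a,b). a \<in> \<rat> \<and> b \<in> \<rat> \<and> a < b}"

lemma countable_rat_intervals [simp]: "countable rat_intervals"
  by (rule countable_subset[of _ "\<rat> \<times> \<rat>"]) (auto simp: rat_intervals_def countable_rat)

text \<open>Membership of \<open>x\<close> is expressed by an indicator, so that the index set is
  the same countable set for every \<open>x\<close> and measurability is that of a countable
  supremum. With \<open>lborel\<close> this is the unweighted operator, with a density the weighted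
  one.\<close>

definition interval_maximal :: "real measure \<Rightarrow> (real \<Rightarrow> ennreal) \<Rightarrow> real \<Rightarrow> ennreal" where
  "interval_maximal \<mu> g x = (SUP (a,b)\<in>rat_intervals.
     (\<integral>\<^sup>+t\<in>{a..b}. g t \<partial>\<mu>) / emeasure \<mu> {a..b} * indicator {a..b} x)"

lemma interval_maximal_ge:
  assumes "(a,b) \<in> rat_intervals" "x \<in> {a..b}"
  shows "(\<integral>\<^sup>+t\<in>{a..b}. g t \<partial>\<mu>) / emeasure \<mu> {a..b} \<le> interval_maximal \<mu> g x"
  unfolding interval_maximal_def using assms by (intro SUP_upper2[OF assms(1)]) auto

lemma interval_maximal_le:
  assumes "\<And>a b. (a,b) \<in> rat_intervals \<Longrightarrow> x \<in> {a..b} \<Longrightarrow>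
    (\<integral>\<^sup>+t\<in>{a..b}. g t \<partial>\<mu>) / emeasure \<mu> {a..b} \<le> C"
  shows "interval_maximal \<mu> g x \<le> C"
  unfolding interval_maximal_def using assms by (auto intro!: SUP_least simp: indicator_def)

lemma less_interval_maximal:
  assumes "C < interval_maximal \<mu> g x"
  obtains a b where "(a,b) \<in> rat_intervals" "x \<in> {a..b}"
    "C < (\<integral>\<^sup>+t\<in>{a..b}. g t \<partial>\<mu>) / emeasure \<mu> {a..b}"
  using assms interval_maximal_le[of x \<mu> g C] by (meson leD not_le)

lemma borel_measurable_interval_maximal:
  fixes M \<mu> :: "real measure"
  assumes "sets M = sets borel"
  shows "interval_maximal \<mu> g \<in> borel_measurable M"
proof -
  have [measurable]: "{a..b::real} \<in> sets M" for a b using assms by simp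
  show ?thesis
    unfolding interval_maximal_def[abs_def] case_prod_beta
    by (intro borel_measurable_SUP) auto
qed

lemma ennreal_divide_mult_cancel:
  fixes y z :: ennreal
  assumes "z \<noteq> 0" "z \<noteq> top"
  shows "y / z * z = y"
  by (subst mult.commute, subst ennreal_times_divide, subst mult.commute)
    (rule mult_divide_eq_ennreal[OF assms])

lemma ennreal_mult_le_of_less_divide:
  fixes x y z :: ennreal
  assumes "x < y / z"
  shows "x * z \<le> y"
proof -
  have "z \<noteq> top" using assms by (auto simp: divide_ennreal_def)
  show ?thesis
  proof (cases "z = 0")
    case False
    have "x * z \<le> y / z * z" using assms by (intro mult_right_mono) auto
    also have "\<dots> = y" using False \<open>z \<noteq> top\<close> by (rule ennreal_divide_mult_cancel)
    finally show ?thesis .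
  qed simp
qed

text \<open>The constant 2 is the overlap bound of \<open>minimal_interval_cover\<close>: the
  integrals of \<open>g\<close> over the selected intervals count each point at most twice. The
  covering lemma handles finite families only, so the countable family \<open>Q\<close> is exhausted
  by finite ones and the measure is continuous from below.\<close>

lemma interval_maximal_weak_type:
  assumes [measurable_cong, simp]: "sets \<mu> = sets borel" and [measurable]: "g \<in> borel_measurable \<mu>"
  shows "l * emeasure \<mu> {x. l < interval_maximal \<mu> g x} \<le> 2 * (\<integral>\<^sup>+x. g x \<partial>\<mu>)"
proof -
  define Q where "Q = {(a,b)\<in>rat_intervals. l * emeasure \<mu> {a..b} \<le> (\<integral>\<^sup>+t\<in>{a..b}. g t \<partial>\<mu>)}"
  have [measurable]: "{a..b::real} \<in> sets \<mu>" for a b by simp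
  have fin: "l * emeasure \<mu> (\<Union>I\<in>F. {fst I..snd I}) \<le> 2 * (\<integral>\<^sup>+x. g x \<partial>\<mu>)" if "finite F" "F \<subseteq> Q" for F
  proof -
    obtain G where G: "G \<subseteq> F" "(\<Union>I\<in>G. {fst I..snd I}) = (\<Union>I\<in>F. {fst I..snd I})"
      "\<And>x. card {I\<in>G. x \<in> {fst I..snd I}} \<le> 2"
      using minimal_interval_cover[OF \<open>finite F\<close>] by blast
    have finG: "finite G" using G(1) that(1) by (rule finite_subset)
    have "emeasure \<mu> (\<Union>I\<in>F. {fst I..snd I}) = emeasure \<mu> (\<Union>I\<in>G. {fst I..snd I})" using G by simp
    also have "\<dots> \<le> (\<Sum>I\<in>G. emeasure \<mu> {fst I..snd I})"
      using finG by (intro emeasure_subadditive_finite) auto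
    finally have "l * emeasure \<mu> (\<Union>I\<in>F. {fst I..snd I}) \<le> (\<Sum>I\<in>G. l * emeasure \<mu> {fst I..snd I})"
      by (subst sum_distrib_left[symmetric]) (rule mult_left_mono, auto)
    also have "\<dots> \<le> (\<Sum>I\<in>G. (\<integral>\<^sup>+t\<in>{fst I..snd I}. g t \<partial>\<mu>))"
      using G(1) that(2) by (intro sum_mono) (auto simp: Q_def)
    also have "\<dots> = (\<integral>\<^sup>+t. (\<Sum>I\<in>G. g t * indicator {fst I..snd I} t) \<partial>\<mu>)"
      by (subst nn_integral_sum) auto
    also have "\<dots> \<le> (\<integral>\<^sup>+t. 2 * g t \<partial>\<mu>)"
    proof (rule nn_integral_mono)
      fix t
      have "(\<Sum>I\<in>G. g t * indicator {fst I..snd I} t) = (\<Sum>I\<in>{I\<in>G. t \<in> {fst I..snd I}}. g t)"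
        using finG by (intro sum.mono_neutral_cong_right) (auto simp: indicator_def)
      also have "\<dots> = of_nat (card {I\<in>G. t \<in> {fst I..snd I}}) * g t" by simp
      also have "\<dots> \<le> 2 * g t"
        using G(3)[of t] by (intro mult_right_mono) (metis of_nat_le_iff of_nat_numeral, simp)
      finally show "(\<Sum>I\<in>G. g t * indicator {fst I..snd I} t) \<le> 2 * g t" .
    qed
    also have "\<dots> = 2 * (\<integral>\<^sup>+x. g x \<partial>\<mu>)" by (simp add: nn_integral_cmult)
    finally show ?thesis .
  qed
  have sub: "{x. l < interval_maximal \<mu> g x} \<subseteq> (\<Union>I\<in>Q. {fst I..snd I})"
    by (force simp: Q_def elim: less_interval_maximal dest: ennreal_mult_le_of_less_divide)
  show ?thesis
  proof (cases "Q = {}")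
    case True
    then show ?thesis using sub by auto
  next
    case False
    have "countable Q" by (rule countable_subset[OF _ countable_rat_intervals]) (auto simp: Q_def)
    define e where "e = from_nat_into Q"
    have e: "range e = Q" unfolding e_def using False \<open>countable Q\<close> by (rule range_from_nat_into)
    define U where "U = (\<lambda>n. \<Union>I\<in>e ` {..n::nat}. {fst I..snd I})"
    have "(\<Union>I\<in>Q. {fst I..snd I}) = (\<Union>n. U n)"
      unfolding U_def e[symmetric] by blast
    then have "l * emeasure \<mu> {x. l < interval_maximal \<mu> g x} \<le> l * emeasure \<mu> (\<Union>n. U n)"
      using sub by (intro mult_left_mono emeasure_mono) (auto simp: U_def)
    also have "\<dots> = l * (SUP n. emeasure \<mu> (U n))"
      by (subst SUP_emeasure_incseq) (force simp: U_def incseq_def)+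
    also have "\<dots> = (SUP n. l * emeasure \<mu> (U n))" by (rule SUP_mult_left_ennreal)
    also have "\<dots> \<le> 2 * (\<integral>\<^sup>+x. g x \<partial>\<mu>)"
      unfolding U_def using e by (intro SUP_least fin) auto
    finally show ?thesis .
  qed
qed

lemma epowr_mult_self: "0 < a \<Longrightarrow> x * epowr x a = epowr x (a + 1)"
  by (cases x) (auto simp: epowr_ennreal powr_add powr_one_gt_zero_iff ennreal_mult_eq_top_iff mult.commute
      simp flip: ennreal_mult)

text \<open>Origin of the factors: 4 is the weak-type constant 2, doubled by passing to half the
  level; \<open>2 powr (q - 1) / (q - 1)\<close> comes from integrating \<open>t^(q-2)\<close> up to
  \<open>2 * g x\<close>; \<open>q\<close> undoes the \<open>1 / q\<close> of the layer-cake
  formula.\<close>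

definition maximal_const :: "real \<Rightarrow> real" where
  "maximal_const q = 4 * q / (q - 1) * 2 powr (q - 1)"

text \<open>The part of \<open>g\<close> with values at most \<open>l\<close> contributes at most
  \<open>l\<close> to each average.\<close>

lemma interval_maximal_truncate:
  assumes [measurable_cong]: "sets \<mu> = sets borel" and [measurable]: "g \<in> borel_measurable \<mu>"
  shows "interval_maximal \<mu> g x \<le> interval_maximal \<mu> (\<lambda>y. if l < g y then g y else 0) x + l"
proof (rule interval_maximal_le)
  fix a b assume ab: "(a,b) \<in> rat_intervals" "x \<in> {a..b}"
  let ?h = "\<lambda>y. if l < g y then g y else 0"
  have [measurable]: "{a..b} \<in> sets \<mu>" using assms(1) by simp
  have "(\<integral>\<^sup>+t\<in>{a..b}. g t \<partial>\<mu>) \<le> (\<integral>\<^sup>+t. ?h t * indicator {a..b} t + l * indicator {a..b} t \<partial>\<mu>)"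
    by (intro nn_integral_mono) (auto simp: indicator_def)
  also have "\<dots> = (\<integral>\<^sup>+t\<in>{a..b}. ?h t \<partial>\<mu>) + l * emeasure \<mu> {a..b}"
    by (subst nn_integral_add) (auto simp: nn_integral_cmult_indicator)
  finally have "(\<integral>\<^sup>+t\<in>{a..b}. g t \<partial>\<mu>) / emeasure \<mu> {a..b}
      \<le> (\<integral>\<^sup>+t\<in>{a..b}. ?h t \<partial>\<mu>) / emeasure \<mu> {a..b} + l * emeasure \<mu> {a..b} / emeasure \<mu> {a..b}"
    by (metis add_divide_distrib_ennreal divide_right_mono_ennreal)
  \<comment> \<open>Equality can fail: by the conventions for division in \<open>ennreal\<close>,
    the quotient is 0 if the interval has measure 0 or infinity.\<close>
  also have "l * emeasure \<mu> {a..b} / emeasure \<mu> {a..b} \<le> l"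
  proof (cases "emeasure \<mu> {a..b} = 0 \<or> emeasure \<mu> {a..b} = top")
    case True
    then show ?thesis by (auto simp: divide_ennreal_def)
  qed (simp add: mult_divide_eq_ennreal)
  also have "(\<integral>\<^sup>+t\<in>{a..b}. ?h t \<partial>\<mu>) / emeasure \<mu> {a..b} \<le> interval_maximal \<mu> ?h x"
    by (rule interval_maximal_ge[OF ab])
  finally show "(\<integral>\<^sup>+t\<in>{a..b}. g t \<partial>\<mu>) / emeasure \<mu> {a..b} \<le> interval_maximal \<mu> ?h x + l"
    by (simp add: add_mono)
qed

text \<open>At level \<open>t\<close> only the part of \<open>g\<close> above \<open>t/2\<close>
  matters, so \<open>t\<close> times the measure of the level set is at most 4 times the integral of
  \<open>g\<close> over the set where \<open>2 g > t\<close>. Integrating this against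
  \<open>t^(q-2) dt\<close> and exchanging the integrals leaves the integral of
  \<open>t^(q-2)\<close> over \<open>(0, 2 g)\<close>, which converges at 0 because
  \<open>1 < q\<close>.\<close>

lemma interval_maximal_strong_type:
  assumes q: "1 < q" and "sigma_finite_measure \<mu>"
    and [measurable_cong]: "sets \<mu> = sets borel" and [measurable]: "g \<in> borel_measurable \<mu>"
  shows "(\<integral>\<^sup>+x. epowr (interval_maximal \<mu> g x) q \<partial>\<mu>)
    \<le> ennreal (maximal_const q) * (\<integral>\<^sup>+x. epowr (g x) q \<partial>\<mu>)"
proof -
  interpret mu: sigma_finite_measure \<mu> by fact
  interpret pair_sigma_finite "lborel :: real measure" \<mu> ..
  note [measurable] = borel_measurable_interval_maximal[OF assms(3)]
  let ?M = "interval_maximal \<mu> g"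
  have sp: "space \<mu> = UNIV" using sets_eq_imp_space_eq[OF assms(3)] by simp
  have weak: "ennreal t * emeasure \<mu> {x. ennreal t < ?M x}
      \<le> 4 * (\<integral>\<^sup>+x. (if ennreal t < 2 * g x then g x else 0) \<partial>\<mu>)" if "0 < t" for t
  proof -
    let ?h = "\<lambda>y. if ennreal (t / 2) < g y then g y else 0"
    have half: "ennreal (t/2) + ennreal (t/2) = ennreal t" using that by (simp flip: ennreal_plus)
    have sub: "{x. ennreal t < ?M x} \<subseteq> {x. ennreal (t/2) < interval_maximal \<mu> ?h x}"
    proof clarify
      fix x assume "ennreal t < ?M x"
      then have "ennreal (t/2) + ennreal (t/2) < interval_maximal \<mu> ?h x + ennreal (t/2)"
        using interval_maximal_truncate[OF assms(3,4), of x "ennreal (t/2)"] half by (metis order_less_le_trans)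
      then show "ennreal (t/2) < interval_maximal \<mu> ?h x"
        by (meson add_right_mono leD not_le)
    qed
    have [measurable]: "{x. ennreal (t/2) < interval_maximal \<mu> ?h x} \<in> sets \<mu>"
    proof -
      have "interval_maximal \<mu> ?h \<in> borel_measurable \<mu>"
        by (rule borel_measurable_interval_maximal[OF assms(3)])
      then have "{x\<in>space \<mu>. ennreal (t/2) < interval_maximal \<mu> ?h x} \<in> sets \<mu>" by measurable
      then show ?thesis by (simp add: sp)
    qed
    have "ennreal (t/2) * emeasure \<mu> {x. ennreal t < ?M x}
        \<le> ennreal (t/2) * emeasure \<mu> {x. ennreal (t/2) < interval_maximal \<mu> ?h x}"
      using sub by (intro mult_left_mono emeasure_mono) auto
    also have "\<dots> \<le> 2 * (\<integral>\<^sup>+x. ?h x \<partial>\<mu>)"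
      by (intro interval_maximal_weak_type assms(3)) measurable
    finally have "2 * (ennreal (t/2) * emeasure \<mu> {x. ennreal t < ?M x}) \<le> 2 * (2 * (\<integral>\<^sup>+x. ?h x \<partial>\<mu>))"
      by (rule mult_left_mono) simp
    moreover have "2 * ennreal (t/2) = ennreal t"
      using half by (simp add: mult_2)
    moreover have "(ennreal (t/2) < y) = (ennreal t < 2 * y)" for y
      using that by (cases y) (auto simp: ennreal_less_iff ennreal_mult_top simp flip: ennreal_numeral ennreal_mult)
    ultimately show ?thesis by (simp add: mult.assoc[symmetric])
  qed
  have "ennreal (1 / q) * (\<integral>\<^sup>+x. epowr (?M x) q \<partial>\<mu>)
      = (\<integral>\<^sup>+x. \<integral>\<^sup>+t. (if 0 < t \<and> ennreal t < ?M x then ennreal (t powr (q - 1)) else 0) \<partial>lborel \<partial>\<mu>)"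
    using q by (subst epowr_layer_cake) (auto simp: nn_integral_cmult)
  also have "\<dots> = (\<integral>\<^sup>+t. \<integral>\<^sup>+x. (if 0 < t \<and> ennreal t < ?M x then ennreal (t powr (q - 1)) else 0) \<partial>\<mu> \<partial>lborel)"
    by (rule Fubini') measurable
  also have "\<dots> \<le> (\<integral>\<^sup>+t. \<integral>\<^sup>+x. 4 * (g x * (if 0 < t \<and> ennreal t < 2 * g x then ennreal (t powr (q - 1 - 1)) else 0)) \<partial>\<mu> \<partial>lborel)"
  proof (rule nn_integral_mono)
    fix t :: real
    show "(\<integral>\<^sup>+x. (if 0 < t \<and> ennreal t < ?M x then ennreal (t powr (q - 1)) else 0) \<partial>\<mu>)
      \<le> (\<integral>\<^sup>+x. 4 * (g x * (if 0 < t \<and> ennreal t < 2 * g x then ennreal (t powr (q - 1 - 1)) else 0)) \<partial>\<mu>)"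
    proof (cases "0 < t")
      case True
      have [measurable]: "{x. ennreal t < ?M x} \<in> sets \<mu>"
      proof -
        have "{x\<in>space \<mu>. ennreal t < ?M x} \<in> sets \<mu>" by measurable
        then show ?thesis by (simp add: sp)
      qed
      have "t powr (q - 1) = t powr (q - 1 - 1) * t"
        using True powr_add[of t "q - 1 - 1" 1] by simp
      then have pw: "ennreal (t powr (q - 1)) = ennreal (t powr (q - 1 - 1)) * ennreal t"
        using True by (simp flip: ennreal_mult)
      have "(\<integral>\<^sup>+x. (if 0 < t \<and> ennreal t < ?M x then ennreal (t powr (q - 1)) else 0) \<partial>\<mu>)
          = (\<integral>\<^sup>+x. ennreal (t powr (q - 1)) * indicator {x. ennreal t < ?M x} x \<partial>\<mu>)"
        using True by (intro nn_integral_cong) (auto simp: indicator_def)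
      also have "\<dots> = ennreal (t powr (q - 1 - 1)) * (ennreal t * emeasure \<mu> {x. ennreal t < ?M x})"
        by (subst nn_integral_cmult_indicator) (auto simp: pw mult.assoc)
      also have "\<dots> \<le> ennreal (t powr (q - 1 - 1)) * (4 * (\<integral>\<^sup>+x. (if ennreal t < 2 * g x then g x else 0) \<partial>\<mu>))"
        by (intro mult_left_mono weak True) auto
      also have "\<dots> = (\<integral>\<^sup>+x. ennreal (t powr (q - 1 - 1)) * (4 * (if ennreal t < 2 * g x then g x else 0)) \<partial>\<mu>)"
        by (simp add: nn_integral_cmult)
      also have "\<dots> = (\<integral>\<^sup>+x. 4 * (g x * (if 0 < t \<and> ennreal t < 2 * g x then ennreal (t powr (q - 1 - 1)) else 0)) \<partial>\<mu>)"
        using True by (intro nn_integral_cong) (auto simp: ac_simps)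
      finally show ?thesis .
    qed simp
  qed
  also have "\<dots> = (\<integral>\<^sup>+x. \<integral>\<^sup>+t. 4 * (g x * (if 0 < t \<and> ennreal t < 2 * g x then ennreal (t powr (q - 1 - 1)) else 0)) \<partial>lborel \<partial>\<mu>)"
    by (rule Fubini'[symmetric]) measurable
  also have "\<dots> = (\<integral>\<^sup>+x. 4 * (g x * (ennreal (1 / (q - 1)) * epowr (2 * g x) (q - 1))) \<partial>\<mu>)"
    using q by (simp add: nn_integral_cmult epowr_layer_cake)
  also have "\<dots> = (\<integral>\<^sup>+x. ennreal (4 * 2 powr (q - 1) / (q - 1)) * epowr (g x) q \<partial>\<mu>)"
  proof (rule nn_integral_cong)
    fix x
    have "epowr (2 * g x) (q - 1) = ennreal (2 powr (q - 1)) * epowr (g x) (q - 1)"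
      using q epowr_ennreal[of 2 "q - 1"] by (subst epowr_mult) auto
    then have "4 * (g x * (ennreal (1 / (q - 1)) * epowr (2 * g x) (q - 1)))
        = (4 * ennreal (1 / (q - 1)) * ennreal (2 powr (q - 1))) * (g x * epowr (g x) (q - 1))"
      by (simp add: ac_simps)
    also have "4 * ennreal (1 / (q - 1)) * ennreal (2 powr (q - 1)) = ennreal (4 * 2 powr (q - 1) / (q - 1))"
      using q by (simp add: ac_simps flip: ennreal_numeral ennreal_mult)
    also have "g x * epowr (g x) (q - 1) = epowr (g x) q"
      using q by (subst epowr_mult_self) auto
    finally show "4 * (g x * (ennreal (1 / (q - 1)) * epowr (2 * g x) (q - 1)))
      = ennreal (4 * 2 powr (q - 1) / (q - 1)) * epowr (g x) q" .
  qed
  also have "\<dots> = ennreal (4 * 2 powr (q - 1) / (q - 1)) * (\<integral>\<^sup>+x. epowr (g x) q \<partial>\<mu>)"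
    by (simp add: nn_integral_cmult)
  finally have "ennreal q * (ennreal (1 / q) * (\<integral>\<^sup>+x. epowr (?M x) q \<partial>\<mu>))
    \<le> ennreal q * (ennreal (4 * 2 powr (q - 1) / (q - 1)) * (\<integral>\<^sup>+x. epowr (g x) q \<partial>\<mu>))"
    by (rule mult_left_mono) simp
  moreover have "ennreal q * ennreal (1 / q) = 1"
    using q by (simp flip: ennreal_mult)
  moreover have "ennreal q * ennreal (4 * 2 powr (q - 1) / (q - 1)) = ennreal (maximal_const q)"
    using q by (simp add: maximal_const_def ac_simps flip: ennreal_mult)
  ultimately show ?thesis by (simp add: mult.assoc[symmetric])
qed

subsection \<open>The one-dimensional estimate\<close>

lemma ennreal_divide_mult_divide:
  fixes x y z :: ennreal
  assumes "y \<noteq> 0" "y \<noteq> top"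
  shows "x / y * (y / z) = x / z"
proof -
  have "x / y * (y / z) = x * (inverse y * y) / z"
    by (simp add: divide_ennreal_def ac_simps)
  also have "inverse y * y = 1"
    using assms ennreal_divide_self[of y] by (simp add: divide_ennreal_def mult.commute top.not_eq_extremum)
  finally show ?thesis by simp
qed

lemma ennreal_le_divideI:
  fixes x y z :: ennreal
  assumes "x * y \<le> z" "y \<noteq> 0" "y \<noteq> top"
  shows "x \<le> z / y"
  using divide_right_mono_ennreal[OF assms(1), of y] assms(2,3) by (simp add: mult_divide_eq_ennreal)

lemma real_parallelepiped_iff:
  "P \<in> parallelepipeds \<longleftrightarrow> (\<exists>a b. P = {a..b::real} \<and> a < b)"
  unfolding parallelepipeds_def by auto

lemma avg_Icc:
  "a < b \<Longrightarrow> avg {a..b} g = (\<integral>\<^sup>+t\<in>{a..b}. g t \<partial>lborel) / ennreal (b - a)"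
  by (simp add: avg_def nn_integral_completion)

lemma conj_exp_simps:
  assumes "1 < p"
  shows "1 < conj_exp p" "(p - 1) * conj_exp p = p" "1 - conj_exp p = - 1 / (p - 1)"
    "(1 - conj_exp p) * (1 - p) = 1"
  using assms by (auto simp: conj_exp_def field_simps)

lemma nn_integral_Icc_pos:
  fixes h :: "real \<Rightarrow> real"
  assumes [measurable]: "h \<in> borel_measurable borel" and "\<And>t. 0 < h t" and "a < b"
  shows "(\<integral>\<^sup>+t\<in>{a..b}. ennreal (h t) \<partial>lborel) \<noteq> 0"
proof
  assume "(\<integral>\<^sup>+t\<in>{a..b}. ennreal (h t) \<partial>lborel) = 0"
  then have "AE t in lborel. ennreal (h t) * indicator {a..b} t = 0"
    by (subst (asm) nn_integral_0_iff_AE) auto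
  then have "AE t in lborel. t \<notin> {a..b}"
    by eventually_elim
      (use assms(2) in \<open>auto simp: indicator_def ennreal_eq_0_iff not_less[symmetric] split: if_splits\<close>)
  then have "emeasure lborel {a..b} = 0"
    by (subst (asm) AE_iff_measurable[of "{a..b}"]) auto
  then show False using \<open>a < b\<close> by simp
qed

text \<open>Models a single slice of the Borel version of the weight. The finite characteristic
  stands in for local integrability, which it implies by \<open>interval_finite\<close>;
  \<open>\<sigma>\<close> is the dual weight.\<close>

locale positive_weight =
  fixes p :: real and w \<sigma> :: "real \<Rightarrow> real"
  assumes p: "1 < p" and w_borel [measurable]: "w \<in> borel_measurable borel" and w_pos: "\<And>t. 0 < w t"
    and Ap_finite: "Ap_const p w < top"
  defines "\<sigma> \<equiv> \<lambda>t. w t powr (1 - conj_exp p)"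
begin

definition "\<mu> = density lborel (\<lambda>t. ennreal (w t))"
definition "\<nu> = density lborel (\<lambda>t. ennreal (\<sigma> t))"

lemma \<sigma>_borel [measurable]: "\<sigma> \<in> borel_measurable borel"
  unfolding \<sigma>_def by measurable

lemma \<sigma>_pos: "0 < \<sigma> t"
  using w_pos[of t] by (simp add: \<sigma>_def)

lemma sets_\<mu>_\<nu> [simp, measurable_cong]: "sets \<mu> = sets borel" "sets \<nu> = sets borel"
  by (simp_all add: \<mu>_def \<nu>_def)

lemma sigma_finite_\<mu>_\<nu>: "sigma_finite_measure \<mu>" "sigma_finite_measure \<nu>"
  unfolding \<mu>_def \<nu>_def
  by (subst sigma_finite_measure.sigma_finite_iff_density_finite;
      simp add: lborel.sigma_finite_measure_axioms)+

lemma Ap_interval: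
  assumes "a < b"
  shows "emeasure \<mu> {a..b} / ennreal (b - a) * epowr (emeasure \<nu> {a..b} / ennreal (b - a)) (p - 1)
    \<le> Ap_const p w"
proof -
  have "avg {a..b} (\<lambda>x. ennreal (w x)) * epowr (avg {a..b} (\<lambda>x. ennreal (\<sigma> x))) (p - 1) \<le> Ap_const p w"
    unfolding Ap_const_def \<sigma>_def by (rule SUP_upper) (use assms real_parallelepiped_iff in blast)
  then show ?thesis
    using assms by (simp add: avg_Icc \<mu>_def \<nu>_def emeasure_density)
qed

text \<open>Both weights are positive, so neither average vanishes; if one of them were infinite,
  the product bounded by the characteristic would be infinite too. The pointwise estimate needs
  these facts to divide and cancel.\<close>

lemma interval_finite:
  assumes "a < b"
  shows "emeasure \<mu> {a..b} \<noteq> 0" "emeasure \<nu> {a..b} \<noteq> 0"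
    "emeasure \<mu> {a..b} \<noteq> top" "emeasure \<nu> {a..b} \<noteq> top"
proof -
  let ?L = "ennreal (b - a)"
  have L: "?L \<noteq> 0" "?L \<noteq> top" using assms by auto
  show W: "emeasure \<mu> {a..b} \<noteq> 0"
    using nn_integral_Icc_pos[OF w_borel w_pos assms] by (simp add: \<mu>_def emeasure_density)
  show S: "emeasure \<nu> {a..b} \<noteq> 0"
    using nn_integral_Icc_pos[OF \<sigma>_borel \<sigma>_pos assms] by (simp add: \<nu>_def emeasure_density)
  have fin: "emeasure \<mu> {a..b} / ?L * epowr (emeasure \<nu> {a..b} / ?L) (p - 1) < top"
    using Ap_interval[OF assms] Ap_finite by (rule le_less_trans)
  show "emeasure \<mu> {a..b} \<noteq> top"
  proof
    assume "emeasure \<mu> {a..b} = top"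
    then have "epowr (emeasure \<nu> {a..b} / ?L) (p - 1) = 0"
      using fin L by (auto simp: ennreal_top_divide ennreal_top_mult split: if_splits)
    then show False using S L by (auto simp: ennreal_divide_eq_0_iff epowr_eq_0_iff)
  qed
  show "emeasure \<nu> {a..b} \<noteq> top"
  proof
    assume "emeasure \<nu> {a..b} = top"
    then have "emeasure \<mu> {a..b} / ?L = 0"
      using fin L by (auto simp: ennreal_top_divide ennreal_mult_top split: if_splits)
    then show False using W L by (auto simp: ennreal_divide_eq_0_iff epowr_eq_0_iff)
  qed
qed

text \<open>
  Lerner's pointwise estimate: with \<open>\<sigma> = w\<^bsup>1-p'\<^esup>\<close>, the unweighted average of \<open>f\<close> over an interval \<open>I\<close>
  to the power \<open>p - 1\<close> is the characteristic on \<open>I\<close> times \<open>|I| / w(I)\<close> times the \<open>(p-1)\<close>-st power of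
  the \<open>\<sigma>\<close>-average of \<open>f / \<sigma>\<close>, and the latter is at most the mean of \<open>M\<^sub>\<sigma>(f/\<sigma>)\<^bsup>p-1\<^esup>\<close> over \<open>I\<close>.
\<close>

lemma interval_maximal_pointwise:
  fixes f :: "real \<Rightarrow> ennreal"
  assumes [measurable]: "f \<in> borel_measurable borel"
  defines "h \<equiv> \<lambda>t. f t * ennreal (1 / \<sigma> t)"
  defines "G \<equiv> \<lambda>t. epowr (interval_maximal \<nu> h t) (p - 1) * ennreal (1 / w t)"
  shows "interval_maximal lborel f x \<le> epowr (Ap_const p w * interval_maximal \<mu> G x) (1 / (p - 1))"
proof (rule interval_maximal_le)
  fix a b assume ab: "(a,b) \<in> rat_intervals" "x \<in> {a..b}"
  then have "a < b" by (auto simp: rat_intervals_def)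
  define L where "L = ennreal (b - a)"
  define W where "W = emeasure \<mu> {a..b}"
  define S where "S = emeasure \<nu> {a..b}"
  define F where "F = (\<integral>\<^sup>+t\<in>{a..b}. f t \<partial>lborel)"
  have L: "L \<noteq> 0" "L \<noteq> top" "emeasure lborel {a..b} = L" using \<open>a < b\<close> by (auto simp: L_def)
  note WS = interval_finite[OF \<open>a < b\<close>, folded W_def S_def]
  have [measurable]: "h \<in> borel_measurable borel" unfolding h_def by measurable
  have M\<nu> [measurable]: "interval_maximal \<nu> h \<in> borel_measurable borel"
    by (rule borel_measurable_interval_maximal) simp
  have [measurable]: "G \<in> borel_measurable borel" unfolding G_def by measurable
  have "ennreal (\<sigma> t) * (f t * ennreal (1 / \<sigma> t)) = f t" for t
  proof -
    have "ennreal (\<sigma> t) * ennreal (1 / \<sigma> t) = 1"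
      using \<sigma>_pos[of t] by (simp flip: ennreal_mult)
    then show ?thesis by (metis mult.assoc mult.commute mult_1)
  qed
  then have F: "(\<integral>\<^sup>+t\<in>{a..b}. h t \<partial>\<nu>) = F"
    unfolding \<nu>_def F_def h_def by (subst nn_integral_density) (auto simp: mult.assoc[symmetric])
  have Gw: "ennreal (w t) * G t = epowr (interval_maximal \<nu> h t) (p - 1)" for t
  proof -
    have "ennreal (w t) * ennreal (1 / w t) = 1"
      using w_pos[of t] by (simp flip: ennreal_mult)
    then show ?thesis unfolding G_def by (metis mult.assoc mult.commute mult_1)
  qed
  \<comment> \<open>\<open>F / S\<close> is one of the averages in
    \<open>interval_maximal \<nu> h t\<close> for every \<open>t\<close> in the interval.
    Integrating this constant over the interval bounds it by a mean, and the factor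
    \<open>1 / w\<close> inside \<open>G\<close> turns \<open>dt\<close> into
    \<open>d\<mu>\<close>.\<close>
  have "epowr (F / S) (p - 1) * L = (\<integral>\<^sup>+t. epowr (F / S) (p - 1) * indicator {a..b} t \<partial>lborel)"
    by (simp add: nn_integral_cmult_indicator L)
  also have "\<dots> \<le> (\<integral>\<^sup>+t. ennreal (w t) * (G t * indicator {a..b} t) \<partial>lborel)"
  proof (rule nn_integral_mono)
    fix t
    have "t \<in> {a..b} \<Longrightarrow> F / S \<le> interval_maximal \<nu> h t"
      using interval_maximal_ge[OF ab(1), of t \<nu> h] by (simp add: F S_def)
    then show "epowr (F / S) (p - 1) * indicator {a..b} t \<le> ennreal (w t) * (G t * indicator {a..b} t)"
      using p by (auto simp: indicator_def Gw intro!: epowr_mono)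
  qed
  also have "\<dots> = (\<integral>\<^sup>+t\<in>{a..b}. G t \<partial>\<mu>)"
    unfolding \<mu>_def by (subst nn_integral_density) auto
  finally have J: "epowr (F / S) (p - 1) \<le> (\<integral>\<^sup>+t\<in>{a..b}. G t \<partial>\<mu>) / L"
    using L by (intro ennreal_le_divideI)
  have "epowr (F / L) (p - 1) = epowr (F / S) (p - 1) * epowr (S / L) (p - 1)"
    using WS p by (subst epowr_mult[symmetric]) (auto simp: ennreal_divide_mult_divide)
  \<comment> \<open>Normalising by \<open>W\<close> instead of \<open>L\<close> releases the factor
    \<open>W / L\<close>, which together with \<open>epowr (S / L) (p - 1)\<close> is the A_p
    quotient of the interval.\<close>
  also have "\<dots> \<le> (\<integral>\<^sup>+t\<in>{a..b}. G t \<partial>\<mu>) / W * (W / L) * epowr (S / L) (p - 1)"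
    using WS J by (intro mult_right_mono) (auto simp: ennreal_divide_mult_divide)
  also have "\<dots> \<le> interval_maximal \<mu> G x * Ap_const p w"
    using interval_maximal_ge[OF ab, of \<mu> G] Ap_interval[OF \<open>a < b\<close>]
    unfolding mult.assoc W_def S_def L_def by (intro mult_mono) auto
  finally have "epowr (epowr (F / L) (p - 1)) (1 / (p - 1))
      \<le> epowr (Ap_const p w * interval_maximal \<mu> G x) (1 / (p - 1))"
    using p by (intro epowr_mono) (auto simp: mult.commute)
  then show "(\<integral>\<^sup>+t\<in>{a..b}. f t \<partial>lborel) / emeasure lborel {a..b}
      \<le> epowr (Ap_const p w * interval_maximal \<mu> G x) (1 / (p - 1))"
    using p L by (simp add: epowr_epowr F_def)
qed

text \<open>The p-th power of the pointwise estimate contains the maximal function of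
  \<open>G\<close> to the power p', so the strong type is used first on L^p'(\<mu>) and then on
  L^p(\<nu>). The factors \<open>1 / w\<close> and \<open>1 / \<sigma>\<close> fit these exponents:
  \<open>w * w^(-p') = \<sigma>\<close> leads from the first space to the second, and
  \<open>\<sigma> * \<sigma>^(-p) = w\<close> returns the norm of \<open>f\<close>. The power
  p/(p-1) of the characteristic becomes 1/(p-1) after the p-th root.\<close>

theorem interval_maximal_Ap_bound:
  fixes f :: "real \<Rightarrow> ennreal"
  assumes [measurable]: "f \<in> borel_measurable borel"
  shows "(\<integral>\<^sup>+t. epowr (interval_maximal lborel f t) p * ennreal (w t) \<partial>lborel)
    \<le> ennreal (maximal_const (conj_exp p) * maximal_const p) * epowr (Ap_const p w) (conj_exp p)
        * (\<integral>\<^sup>+t. epowr (f t) p * ennreal (w t) \<partial>lborel)"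
proof -
  define h where "h = (\<lambda>t. f t * ennreal (1 / \<sigma> t))"
  define G where "G = (\<lambda>t. epowr (interval_maximal \<nu> h t) (p - 1) * ennreal (1 / w t))"
  note q = conj_exp_simps[OF p]
  have [measurable]: "h \<in> borel_measurable borel" unfolding h_def by measurable
  have M\<nu> [measurable]: "interval_maximal \<nu> h \<in> borel_measurable borel"
    by (rule borel_measurable_interval_maximal) simp
  have [measurable]: "G \<in> borel_measurable borel" unfolding G_def by measurable
  have M\<mu> [measurable]: "interval_maximal \<mu> G \<in> borel_measurable borel"
    by (rule borel_measurable_interval_maximal) simp
  have pq: "1 / (p - 1) * p = conj_exp p" by (simp add: conj_exp_def)
  have Gpow: "ennreal (w t) * epowr (G t) (conj_exp p) = ennreal (\<sigma> t) * epowr (interval_maximal \<nu> h t) p" for t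
  proof -
    have "epowr (G t) (conj_exp p) = epowr (interval_maximal \<nu> h t) p * ennreal ((1 / w t) powr conj_exp p)"
      using q w_pos[of t] by (simp add: G_def epowr_mult epowr_epowr epowr_ennreal)
    moreover
    have "w t * (1 / w t) powr conj_exp p = \<sigma> t"
      using w_pos[of t] by (simp add: \<sigma>_def powr_diff powr_divide)
    then have "ennreal (w t) * ennreal ((1 / w t) powr conj_exp p) = ennreal (\<sigma> t)"
      using w_pos[of t] by (simp flip: ennreal_mult)
    ultimately show ?thesis
      by (simp only: mult.left_commute[of "ennreal (w t)"]) (simp only: mult.commute)
  qed
  have hpow: "ennreal (\<sigma> t) * epowr (h t) p = epowr (f t) p * ennreal (w t)" for t
  proof -
    have "epowr (h t) p = epowr (f t) p * ennreal ((1 / \<sigma> t) powr p)"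
      using p \<sigma>_pos[of t] by (simp add: h_def epowr_mult epowr_ennreal)
    moreover have "\<sigma> t * (1 / \<sigma> t) powr p = w t"
    proof -
      have "\<sigma> t * (1 / \<sigma> t) powr p = \<sigma> t powr (1 - p)"
        using \<sigma>_pos[of t] by (simp add: powr_diff powr_divide)
      also have "\<dots> = w t"
        using q w_pos[of t] by (simp add: \<sigma>_def powr_powr)
      finally show ?thesis .
    qed
    then have "ennreal (\<sigma> t) * ennreal ((1 / \<sigma> t) powr p) = ennreal (w t)"
      using \<sigma>_pos[of t] by (simp flip: ennreal_mult)
    ultimately show ?thesis
      by (simp only: mult.left_commute[of "ennreal (\<sigma> t)"])
  qed
  have "(\<integral>\<^sup>+t. epowr (interval_maximal lborel f t) p * ennreal (w t) \<partial>lborel)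
      \<le> (\<integral>\<^sup>+t. epowr (Ap_const p w) (conj_exp p) * (ennreal (w t) * epowr (interval_maximal \<mu> G t) (conj_exp p)) \<partial>lborel)"
  proof (rule nn_integral_mono)
    fix t
    have "epowr (interval_maximal lborel f t) p \<le> epowr (epowr (Ap_const p w * interval_maximal \<mu> G t) (1 / (p - 1))) p"
      using interval_maximal_pointwise[OF assms, folded h_def, folded G_def] p by (intro epowr_mono) auto
    also have "\<dots> = epowr (Ap_const p w) (conj_exp p) * epowr (interval_maximal \<mu> G t) (conj_exp p)"
      using q(1) by (simp only: epowr_epowr pq epowr_mult)
    finally show "epowr (interval_maximal lborel f t) p * ennreal (w t)
      \<le> epowr (Ap_const p w) (conj_exp p) * (ennreal (w t) * epowr (interval_maximal \<mu> G t) (conj_exp p))"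
      by (metis mult.assoc mult.commute mult_right_mono zero_le)
  qed
  also have "\<dots> = epowr (Ap_const p w) (conj_exp p) * (\<integral>\<^sup>+t. epowr (interval_maximal \<mu> G t) (conj_exp p) \<partial>\<mu>)"
    unfolding \<mu>_def by (subst nn_integral_density) (auto simp: nn_integral_cmult simp flip: \<mu>_def)
  also have "\<dots> \<le> epowr (Ap_const p w) (conj_exp p) *
      (ennreal (maximal_const (conj_exp p)) * (\<integral>\<^sup>+t. epowr (G t) (conj_exp p) \<partial>\<mu>))"
    by (intro mult_left_mono interval_maximal_strong_type q sigma_finite_\<mu>_\<nu>) auto
  also have "(\<integral>\<^sup>+t. epowr (G t) (conj_exp p) \<partial>\<mu>) = (\<integral>\<^sup>+t. ennreal (w t) * epowr (G t) (conj_exp p) \<partial>lborel)"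
    unfolding \<mu>_def by (subst nn_integral_density) auto
  also have "\<dots> = (\<integral>\<^sup>+t. epowr (interval_maximal \<nu> h t) p \<partial>\<nu>)"
    unfolding Gpow by (subst (2) \<nu>_def) (subst nn_integral_density, auto)
  also have "\<dots> \<le> ennreal (maximal_const p) * (\<integral>\<^sup>+t. epowr (h t) p \<partial>\<nu>)"
    by (intro interval_maximal_strong_type p sigma_finite_\<mu>_\<nu>) auto
  also have "(\<integral>\<^sup>+t. epowr (h t) p \<partial>\<nu>) = (\<integral>\<^sup>+t. epowr (f t) p * ennreal (w t) \<partial>lborel)"
    unfolding \<nu>_def hpow[symmetric] by (subst nn_integral_density) auto
  finally have "(\<integral>\<^sup>+t. epowr (interval_maximal lborel f t) p * ennreal (w t) \<partial>lborel)
    \<le> epowr (Ap_const p w) (conj_exp p) * (ennreal (maximal_const (conj_exp p)) *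
        (ennreal (maximal_const p) * (\<integral>\<^sup>+t. epowr (f t) p * ennreal (w t) \<partial>lborel)))"
    by (simp add: mult_left_mono)
  moreover have "0 \<le> maximal_const p" "0 \<le> maximal_const (conj_exp p)"
    using p q(1) by (simp_all add: maximal_const_def)
  ultimately show ?thesis by (simp add: ennreal_mult ac_simps)
qed

end

subsection \<open>Maximal functions in the coordinate directions\<close>

lemma borel_measurable_vecI:
  fixes f :: "'a \<Rightarrow> real^'n::finite"
  assumes "\<And>i. (\<lambda>x. f x $ i) \<in> borel_measurable M"
  shows "f \<in> borel_measurable M"
  using assms by (subst borel_measurable_euclidean_space) (auto simp: Basis_vec_def inner_axis)

lemma prod_Basis_vec:
  fixes h :: "real^'n::finite \<Rightarrow> 'b::comm_monoid_mult"
  shows "(\<Prod>b\<in>Basis. h b) = (\<Prod>i\<in>UNIV. h (axis i 1))"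
proof -
  have *: "(Basis :: (real^'n) set) = range (\<lambda>i::'n. axis i (1::real))"
    by (auto simp: Basis_vec_def)
  have "inj (\<lambda>i::'n. axis i (1::real))"
    by (auto simp: inj_on_def axis_eq_axis)
  then show ?thesis
    unfolding * by (subst prod.reindex) auto
qed

text \<open>Bridge to finite product measures, where Fubini splits off one coordinate. A Borel
  measure giving every box its volume is Lebesgue measure.\<close>

lemma lborel_vec_eq_PiM:
  "(lborel :: (real^'n::finite) measure) = distr (Pi\<^sub>M UNIV (\<lambda>_. lborel)) borel (\<lambda>y. \<chi> i. y i)"
proof (rule lborel_eqI)
  have [measurable]: "(\<lambda>y. \<chi> i. y i) \<in> Pi\<^sub>M UNIV (\<lambda>_::'n. lborel) \<rightarrow>\<^sub>M (borel :: (real^'n) measure)"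
    by (rule borel_measurable_vecI) simp
  interpret product_sigma_finite "\<lambda>_::'n. lborel :: real measure" ..
  fix l u :: "real^'n"
  assume "\<And>b. b \<in> Basis \<Longrightarrow> l \<bullet> b \<le> u \<bullet> b"
  from this[of "axis i 1" for i] have lu: "l $ i \<le> u $ i" for i
    by (simp add: inner_axis)
  have "emeasure (distr (Pi\<^sub>M UNIV (\<lambda>_. lborel)) borel (\<lambda>y. \<chi> i. y i)) (box l u)
      = emeasure (Pi\<^sub>M UNIV (\<lambda>_. lborel)) (Pi\<^sub>E UNIV (\<lambda>i. {l $ i <..< u $ i}))"
    by (subst emeasure_distr) (auto simp: space_PiM mem_box_cart PiE_def Pi_def intro!: arg_cong2[where f=emeasure])
  also have "\<dots> = (\<Prod>i\<in>UNIV. ennreal (u $ i - l $ i))"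
    by (subst emeasure_PiM) (auto simp: lu)
  also have "\<dots> = (\<Prod>b\<in>Basis. (u - l) \<bullet> b)"
    using lu by (subst prod_Basis_vec) (simp add: inner_axis prod_ennreal)
  finally show "emeasure (distr (Pi\<^sub>M UNIV (\<lambda>_. lborel)) borel (\<lambda>y. \<chi> i. y i)) (box l u)
    = (\<Prod>b\<in>Basis. (u - l) \<bullet> b)" .
qed simp

text \<open>The base point is a function rather than a vector, so that it can be
  \<open>vec_nth x\<close> as well as a point of the product over the remaining coordinates; its
  value at \<open>i\<close> is never read.\<close>

definition set_coord :: "'n \<Rightarrow> ('n \<Rightarrow> real) \<Rightarrow> real \<Rightarrow> real^'n::finite" where
  "set_coord i y t = (\<chi> j. if j = i then t else y j)"

abbreviation others_measure :: "'n::finite \<Rightarrow> ('n \<Rightarrow> real) measure" where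
  "others_measure i \<equiv> Pi\<^sub>M (UNIV - {i}) (\<lambda>_. lborel :: real measure)"

lemma set_coord_nth [simp]: "set_coord i y t $ j = (if j = i then t else y j)"
  by (simp add: set_coord_def)

lemma set_coord_set_coord [simp]: "set_coord i (vec_nth (set_coord i y s)) t = set_coord i y t"
  by (simp add: vec_eq_iff)

lemma measurable_set_coord_pair [measurable]:
  "(\<lambda>(y, t). set_coord i y t) \<in> others_measure i \<Otimes>\<^sub>M lborel \<rightarrow>\<^sub>M borel"
proof (rule borel_measurable_vecI)
  fix j show "(\<lambda>x. (case x of (y, t) \<Rightarrow> set_coord i y t) $ j) \<in> borel_measurable (others_measure i \<Otimes>\<^sub>M lborel)"
    by (cases "j = i") (auto simp: case_prod_beta)
qed

lemma borel_measurable_vec_nth [measurable (raw)]: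
  fixes f :: "'a \<Rightarrow> real^'n::finite"
  assumes "f \<in> borel_measurable M"
  shows "(\<lambda>x. f x $ i) \<in> borel_measurable M"
  by (rule measurable_compose[OF assms borel_measurable_nth])

lemma measurable_set_coord_vec [measurable]:
  "(\<lambda>(x, t). set_coord i (vec_nth x) t) \<in> borel \<Otimes>\<^sub>M lborel \<rightarrow>\<^sub>M borel"
proof (rule borel_measurable_vecI)
  fix j show "(\<lambda>z. (case z of (x, t) \<Rightarrow> set_coord i (vec_nth x) t) $ j) \<in> borel_measurable (borel \<Otimes>\<^sub>M lborel)"
    by (cases "j = i") (auto simp: case_prod_beta)
qed

lemma measurable_set_coord_right:
  "set_coord i y \<in> borel \<rightarrow>\<^sub>M borel"
  by (rule borel_measurable_vecI) simp

lemma nn_integral_slices: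
  fixes g :: "real^'n::finite \<Rightarrow> ennreal"
  assumes [measurable]: "g \<in> borel_measurable borel"
  shows "(\<integral>\<^sup>+x. g x \<partial>lborel) = (\<integral>\<^sup>+y. \<integral>\<^sup>+t. g (set_coord i y t) \<partial>lborel \<partial>others_measure i)"
proof -
  interpret product_sigma_finite "\<lambda>_::'n. lborel :: real measure" ..
  have [measurable]: "(\<lambda>y. \<chi> i. y i) \<in> Pi\<^sub>M UNIV (\<lambda>_::'n. lborel) \<rightarrow>\<^sub>M (borel :: (real^'n) measure)"
    by (rule borel_measurable_vecI) simp
  have U: "insert i (UNIV - {i}) = UNIV" by auto
  have "(\<integral>\<^sup>+x. g x \<partial>lborel) = (\<integral>\<^sup>+y. g (\<chi> i. y i) \<partial>Pi\<^sub>M UNIV (\<lambda>_. lborel))"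
    by (subst lborel_vec_eq_PiM) (simp add: nn_integral_distr)
  also have "\<dots> = (\<integral>\<^sup>+y. g (\<chi> i. y i) \<partial>Pi\<^sub>M (insert i (UNIV - {i})) (\<lambda>_. lborel))"
    by (simp add: U)
  also have "\<dots> = (\<integral>\<^sup>+y. \<integral>\<^sup>+t. g (\<chi> j. (y(i := t)) j) \<partial>lborel \<partial>others_measure i)"
    by (rule product_nn_integral_insert) (auto simp: U)
  also have "\<dots> = (\<integral>\<^sup>+y. \<integral>\<^sup>+t. g (set_coord i y t) \<partial>lborel \<partial>others_measure i)"
    by (simp add: set_coord_def fun_upd_def)
  finally show ?thesis .
qed

text \<open>The exceptional set lies in a Borel null set, and Tonelli makes almost every slice of
  that set null. Passing to a Borel superset is essential, as slices of the exceptional set itself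
  may be nonmeasurable.\<close>

lemma AE_slices:
  fixes P :: "real^'n::finite \<Rightarrow> bool"
  assumes "AE x in lborel. P x"
  shows "AE y in others_measure i. AE t in lborel. P (set_coord i y t)"
proof -
  obtain N where N: "{x. \<not> P x} \<subseteq> N" "N \<in> sets borel" "emeasure lborel N = 0"
    using AE_E[OF assms] by auto
  note [measurable] = N(2)
  have "(\<integral>\<^sup>+y. \<integral>\<^sup>+t. indicator N (set_coord i y t) \<partial>lborel \<partial>others_measure i) = (\<integral>\<^sup>+x. indicator N x \<partial>lborel)"
    by (rule nn_integral_slices[symmetric]) simp
  also have "\<dots> = 0" using N by simp
  finally have "AE y in others_measure i. (\<integral>\<^sup>+t. indicator N (set_coord i y t) \<partial>lborel) = 0"
    by (subst (asm) nn_integral_0_iff_AE) auto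
  then show ?thesis
  proof eventually_elim
    case (elim y)
    note [measurable] = measurable_set_coord_right[of i y]
    from elim have "AE t in lborel. indicator N (set_coord i y t) = (0::ennreal)"
      by (subst (asm) nn_integral_0_iff_AE) auto
    then show ?case
      by eventually_elim (use N(1) in \<open>auto simp: indicator_def split: if_splits\<close>)
  qed
qed

section \<open>Iterated maximal functions in the coordinate directions\<close>

definition slice_maximal :: "'n \<Rightarrow> (real^'n::finite \<Rightarrow> ennreal) \<Rightarrow> real^'n \<Rightarrow> ennreal" where
  "slice_maximal i g x = interval_maximal lborel (\<lambda>t. g (set_coord i (vec_nth x) t)) (x $ i)"

text \<open>Each average over a fixed rational interval is Borel in \<open>x\<close> by the joint
  measurability of \<open>set_coord\<close>, and only countably many are compared. This is what
  permits iteration.\<close>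

lemma borel_measurable_slice_maximal [measurable]:
  assumes [measurable]: "g \<in> borel_measurable borel"
  shows "slice_maximal i g \<in> borel_measurable borel"
  unfolding slice_maximal_def[abs_def] interval_maximal_def case_prod_beta
  by (intro borel_measurable_SUP) auto

text \<open>On each line parallel to the i-th axis, \<open>slice_maximal i g\<close> is the maximal
  function of the restriction of \<open>g\<close> to that line. The one-dimensional constant depends
  on the line only through its characteristic, almost always at most \<open>A\<close>, so the bounds
  integrate over the remaining coordinates.\<close>

lemma slice_maximal_bound:
  fixes w :: "real^'n::finite \<Rightarrow> real" and g :: "real^'n \<Rightarrow> ennreal"
  assumes p: "1 < p" and [measurable]: "w \<in> borel_measurable borel" and w: "\<And>x. 0 < w x"
    and A: "AE y in others_measure i. Ap_const p (\<lambda>t. w (set_coord i y t)) \<le> A" "A < top"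
    and [measurable]: "g \<in> borel_measurable borel"
  shows "(\<integral>\<^sup>+x. epowr (slice_maximal i g x) p * ennreal (w x) \<partial>lborel)
    \<le> ennreal (maximal_const (conj_exp p) * maximal_const p) * epowr A (conj_exp p)
        * (\<integral>\<^sup>+x. epowr (g x) p * ennreal (w x) \<partial>lborel)"
proof -
  let ?K = "ennreal (maximal_const (conj_exp p) * maximal_const p)"
  have "(\<integral>\<^sup>+x. epowr (slice_maximal i g x) p * ennreal (w x) \<partial>lborel)
    = (\<integral>\<^sup>+y. \<integral>\<^sup>+t. epowr (slice_maximal i g (set_coord i y t)) p * ennreal (w (set_coord i y t)) \<partial>lborel \<partial>others_measure i)"
    by (rule nn_integral_slices) simp
  also have "\<dots> \<le> (\<integral>\<^sup>+y. ?K * epowr A (conj_exp p) *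
      (\<integral>\<^sup>+t. epowr (g (set_coord i y t)) p * ennreal (w (set_coord i y t)) \<partial>lborel) \<partial>others_measure i)"
  proof (rule nn_integral_mono_AE, use A(1) in eventually_elim)
    case (elim y)
    note [measurable] = measurable_set_coord_right[of i y]
    have pw: "positive_weight p (\<lambda>t. w (set_coord i y t))"
      by (rule positive_weight.intro) (use p w elim A(2) in auto)
    have "(\<integral>\<^sup>+t. epowr (slice_maximal i g (set_coord i y t)) p * ennreal (w (set_coord i y t)) \<partial>lborel)
      \<le> ?K * epowr (Ap_const p (\<lambda>t. w (set_coord i y t))) (conj_exp p)
        * (\<integral>\<^sup>+t. epowr (g (set_coord i y t)) p * ennreal (w (set_coord i y t)) \<partial>lborel)"
      unfolding slice_maximal_def using positive_weight.interval_maximal_Ap_bound[OF pw, of "\<lambda>t. g (set_coord i y t)"] by simp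
    also have "\<dots> \<le> ?K * epowr A (conj_exp p)
        * (\<integral>\<^sup>+t. epowr (g (set_coord i y t)) p * ennreal (w (set_coord i y t)) \<partial>lborel)"
      using elim conj_exp_simps(1)[OF p] by (intro mult_right_mono mult_left_mono epowr_mono) auto
    finally show ?case .
  qed
  also have "\<dots> = ?K * epowr A (conj_exp p) * (\<integral>\<^sup>+x. epowr (g x) p * ennreal (w x) \<partial>lborel)"
    by (subst nn_integral_slices[of _ i]) (auto simp: nn_integral_cmult)
  finally show ?thesis .
qed

lemma borel_measurable_foldr_slice_maximal [measurable]:
  "g \<in> borel_measurable borel \<Longrightarrow> foldr slice_maximal L g \<in> borel_measurable borel"
  by (induction L) auto

text \<open>Each direction costs one factor from the line and one power of its own characteristic;
  as \<open>L\<close> is distinct, these powers multiply to the product over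
  \<open>set L\<close>.\<close>

lemma foldr_slice_maximal_bound:
  fixes w :: "real^'n::finite \<Rightarrow> real" and g :: "real^'n \<Rightarrow> ennreal"
  assumes p: "1 < p" and [measurable]: "w \<in> borel_measurable borel" and w: "\<And>x. 0 < w x"
    and A: "\<And>i. AE y in others_measure i. Ap_const p (\<lambda>t. w (set_coord i y t)) \<le> A i" "\<And>i. A i < top"
    and [measurable]: "g \<in> borel_measurable borel"
    and "distinct L"
  shows "(\<integral>\<^sup>+x. epowr (foldr slice_maximal L g x) p * ennreal (w x) \<partial>lborel)
    \<le> ennreal (maximal_const (conj_exp p) * maximal_const p) ^ length L
        * epowr (\<Prod>i\<in>set L. A i) (conj_exp p)
        * (\<integral>\<^sup>+x. epowr (g x) p * ennreal (w x) \<partial>lborel)"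
  using \<open>distinct L\<close>
proof (induction L)
  case Nil
  then show ?case using epowr_ennreal[of 1] by simp
next
  case (Cons i L)
  let ?K = "ennreal (maximal_const (conj_exp p) * maximal_const p)"
  let ?I = "\<integral>\<^sup>+x. epowr (g x) p * ennreal (w x) \<partial>lborel"
  have "(\<integral>\<^sup>+x. epowr (foldr slice_maximal (i # L) g x) p * ennreal (w x) \<partial>lborel)
     \<le> ?K * epowr (A i) (conj_exp p) * (\<integral>\<^sup>+x. epowr (foldr slice_maximal L g x) p * ennreal (w x) \<partial>lborel)"
    unfolding foldr_Cons o_def by (intro slice_maximal_bound assms) measurable
  also have "\<dots> \<le> ?K * epowr (A i) (conj_exp p) * (?K ^ length L * epowr (\<Prod>i\<in>set L. A i) (conj_exp p) * ?I)"
    using Cons by (intro mult_left_mono) auto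
  also have "\<dots> = ?K ^ length (i # L) * (epowr (A i) (conj_exp p) * epowr (\<Prod>i\<in>set L. A i) (conj_exp p)) * ?I"
    by (simp add: ac_simps)
  also have "epowr (A i) (conj_exp p) * epowr (\<Prod>i\<in>set L. A i) (conj_exp p) = epowr (\<Prod>i\<in>set (i # L). A i) (conj_exp p)"
    using Cons(2) conj_exp_simps(1)[OF p] by (simp add: epowr_mult)
  finally show ?case .
qed

section \<open>Box averages as iterated averages\<close>

definition slice_avg :: "('n \<Rightarrow> real) \<Rightarrow> ('n \<Rightarrow> real) \<Rightarrow> 'n \<Rightarrow> (real^'n::finite \<Rightarrow> ennreal) \<Rightarrow> real^'n \<Rightarrow> ennreal" where
  "slice_avg a b i g x = (\<integral>\<^sup>+t\<in>{a i..b i}. g (set_coord i (vec_nth x) t) \<partial>lborel) / emeasure lborel {a i..b i}"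

lemma borel_measurable_slice_avg [measurable]:
  assumes [measurable]: "g \<in> borel_measurable borel"
  shows "slice_avg a b i g \<in> borel_measurable borel"
  unfolding slice_avg_def[abs_def] by measurable

lemma borel_measurable_foldr_slice_avg [measurable]:
  "g \<in> borel_measurable borel \<Longrightarrow> foldr (slice_avg a b) L g \<in> borel_measurable borel"
  by (induction L) auto

context
  fixes a b :: "'n::finite \<Rightarrow> real" and Q :: "(real^'n) set"
  assumes ab: "\<And>i. (a i, b i) \<in> rat_intervals"
  defines "Q \<equiv> {x. \<forall>i. x $ i \<in> {a i..b i}}"
begin

lemma set_coord_Q: "x \<in> Q \<Longrightarrow> t \<in> {a i..b i} \<Longrightarrow> set_coord i (vec_nth x) t \<in> Q"
  by (auto simp: Q_def)

lemma Q_borel [measurable]: "Q \<in> sets borel"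
proof -
  have "Q = cbox (\<chi> i. a i) (\<chi> i. b i)" by (auto simp: Q_def mem_box_cart)
  then show ?thesis by simp
qed

text \<open>An average over \<open>{a i..b i}\<close> is dominated only at points whose i-th
  coordinate lies in that interval. Starting in \<open>Q\<close>, the iteration evaluates only at
  points of \<open>Q\<close>, hence the induction for arbitrary \<open>x\<close>.\<close>

lemma foldr_slice_avg_le:
  "x \<in> Q \<Longrightarrow> foldr (slice_avg a b) L g x \<le> foldr slice_maximal L g x"
proof (induction L arbitrary: x)
  case (Cons i L)
  have "foldr (slice_avg a b) (i # L) g x
      \<le> (\<integral>\<^sup>+t\<in>{a i..b i}. foldr slice_maximal L g (set_coord i (vec_nth x) t) \<partial>lborel) / emeasure lborel {a i..b i}"
    unfolding foldr_Cons o_def slice_avg_def[of a b i]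
    using Cons set_coord_Q
    by (intro divide_right_mono_ennreal nn_integral_mono) (auto simp: indicator_def)
  also have "\<dots> \<le> foldr slice_maximal (i # L) g x"
    using Cons(2) unfolding foldr_Cons o_def slice_maximal_def[of i]
    by (intro interval_maximal_ge ab) (auto simp: Q_def)
  finally show ?case .
qed simp

text \<open>Averaging in direction \<open>i\<close> erases the dependence on the i-th coordinate and
  introduces no other. After all directions a constant function remains.\<close>

lemma foldr_slice_avg_const:
  "(\<And>j. j \<notin> set L \<Longrightarrow> x $ j = x' $ j) \<Longrightarrow> foldr (slice_avg a b) L g x = foldr (slice_avg a b) L g x'"
proof (induction L arbitrary: x x')
  case Nil
  then have "x = x'" by (simp add: vec_eq_iff)
  then show ?case by simp
next
  case (Cons i L)
  have "foldr (slice_avg a b) L g (set_coord i (vec_nth x) t) = foldr (slice_avg a b) L g (set_coord i (vec_nth x') t)" for t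
    using Cons(2) by (intro Cons(1)) auto
  then show ?case by (simp add: slice_avg_def[of a b i])
qed

text \<open>On a line in direction \<open>i\<close> that meets \<open>Q\<close>, the average is
  constant, and its product with the length is again the integral of \<open>g\<close>; the other
  lines contribute nothing.\<close>

lemma nn_integral_slice_avg:
  assumes [measurable]: "g \<in> borel_measurable borel"
  shows "(\<integral>\<^sup>+x\<in>Q. slice_avg a b i g x \<partial>lborel) = (\<integral>\<^sup>+x\<in>Q. g x \<partial>lborel)"
proof -
  let ?L = "emeasure lborel {a i..b i}"
  have L: "?L \<noteq> 0" "?L \<noteq> top" using ab[of i] by (auto simp: rat_intervals_def)
  define R where "R = {y. \<forall>j. j \<noteq> i \<longrightarrow> y j \<in> {a j..b j}}"
  have ind: "indicator Q (set_coord i y t) = (indicator R y * indicator {a i..b i} t :: ennreal)" for y t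
    by (auto simp: Q_def R_def indicator_def)
  have "(\<integral>\<^sup>+t. slice_avg a b i g (set_coord i y t) * indicator Q (set_coord i y t) \<partial>lborel)
    = (\<integral>\<^sup>+t. g (set_coord i y t) * indicator Q (set_coord i y t) \<partial>lborel)" for y
  proof -
    note [measurable] = measurable_set_coord_right[of i y]
    let ?c = "\<integral>\<^sup>+t. g (set_coord i y t) * indicator {a i..b i} t \<partial>lborel"
    have "(\<integral>\<^sup>+t. slice_avg a b i g (set_coord i y t) * indicator Q (set_coord i y t) \<partial>lborel)
      = (\<integral>\<^sup>+t. ?c / ?L * indicator R y * indicator {a i..b i} t \<partial>lborel)"
      by (intro nn_integral_cong) (simp add: slice_avg_def ind ac_simps)
    also have "\<dots> = ?c / ?L * indicator R y * ?L"
      by (rule nn_integral_cmult_indicator) simp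
    also have "\<dots> = indicator R y * ?c"
    proof -
      have "?c / ?L * indicator R y * ?L = indicator R y * (?c / ?L * ?L)"
        by (simp only: ac_simps)
      also have "?c / ?L * ?L = ?c" using L by (rule ennreal_divide_mult_cancel)
      finally show ?thesis .
    qed
    also have "\<dots> = (\<integral>\<^sup>+t. indicator R y * (g (set_coord i y t) * indicator {a i..b i} t) \<partial>lborel)"
      by (rule nn_integral_cmult[symmetric]) simp
    also have "\<dots> = (\<integral>\<^sup>+t. g (set_coord i y t) * indicator Q (set_coord i y t) \<partial>lborel)"
      by (intro nn_integral_cong) (simp add: ind ac_simps)
    finally show ?thesis .
  qed
  moreover have "(\<integral>\<^sup>+x\<in>Q. h x \<partial>lborel)
      = (\<integral>\<^sup>+y. \<integral>\<^sup>+t. h (set_coord i y t) * indicator Q (set_coord i y t) \<partial>lborel \<partial>others_measure i)"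
    if [measurable]: "h \<in> borel_measurable borel" for h
    by (rule nn_integral_slices) simp
  ultimately show ?thesis by simp
qed

text \<open>The iterated average over all directions is constant and has the same integral over
  \<open>Q\<close> as \<open>g\<close>, so it is the mean of \<open>g\<close> over \<open>Q\<close>.
  This identifies the mean by one-coordinate Fubini steps alone.\<close>

lemma avg_le_foldr_slice_maximal:
  assumes [measurable]: "g \<in> borel_measurable borel" and "x \<in> Q" and L: "set L = UNIV"
  shows "(\<integral>\<^sup>+x\<in>Q. g x \<partial>lborel) \<le> foldr slice_maximal L g x * emeasure lborel Q"
proof -
  have "(\<integral>\<^sup>+x\<in>Q. foldr (slice_avg a b) L' g x \<partial>lborel) = (\<integral>\<^sup>+x\<in>Q. g x \<partial>lborel)" for L'
    by (induction L') (simp_all add: nn_integral_slice_avg)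
  from this[of L, symmetric] have "(\<integral>\<^sup>+x\<in>Q. g x \<partial>lborel) = (\<integral>\<^sup>+y. foldr (slice_avg a b) L g x * indicator Q y \<partial>lborel)"
    using L by (auto intro!: nn_integral_cong intro: foldr_slice_avg_const arg_cong2[where f=times])
  also have "\<dots> = foldr (slice_avg a b) L g x * emeasure lborel Q"
    by (rule nn_integral_cmult_indicator) simp
  also have "\<dots> \<le> foldr slice_maximal L g x * emeasure lborel Q"
    by (intro mult_right_mono foldr_slice_avg_le assms) simp
  finally show ?thesis .
qed

end

subsection \<open>The upper bound\<close>

lemma borel_measurable_weight:
  fixes w :: "'a::euclidean_space \<Rightarrow> real"
  assumes "weight w"
  shows "w \<in> borel_measurable lebesgue"
proof (rule borel_measurable_LIMSEQ_real)
  fix x :: 'a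
  obtain N where N: "norm x \<le> real N" using real_arch_simple by blast
  have "eventually (\<lambda>n. indicator (cball 0 (real n)) x *\<^sub>R w x = w x) sequentially"
    using eventually_ge_at_top[of N] by eventually_elim (use N in auto)
  then show "(\<lambda>n. indicator (cball 0 (real n)) x *\<^sub>R w x) \<longlonglongrightarrow> w x"
    by (rule tendsto_eventually)
next
  fix n show "(\<lambda>x. indicator (cball 0 (real n)) x *\<^sub>R w x) \<in> borel_measurable lebesgue"
    using assms unfolding weight_def set_integrable_def by (intro borel_measurable_integrable) auto
qed

lemma borel_positive_version:
  fixes w :: "'a::euclidean_space \<Rightarrow> real"
  assumes "weight w"
  obtains v where "v \<in> borel_measurable borel" "\<And>x. 0 < v x" "AE x in lborel. w x = v x"
proof -
  obtain u where u: "u \<in> borel_measurable lborel" "AE x in lborel. w x = u x"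
    using completion_ex_borel_measurable_real[OF borel_measurable_weight[OF assms]] by auto
  note [measurable] = u(1)
  have pos: "AE x in lborel. 0 < w x"
    using assms by (simp add: weight_def AE_completion_iff)
  show thesis
  proof (rule that)
    show "(\<lambda>x. if 0 < u x then u x else 1) \<in> borel_measurable borel" by measurable
    show "AE x in lborel. w x = (if 0 < u x then u x else 1)"
      using u(2) pos by eventually_elim auto
  qed simp
qed

lemma Ap_const_cong_AE:
  assumes "AE x in lborel. u x = v x"
  shows "Ap_const p u = Ap_const p v"
proof -
  have "avg P (\<lambda>x. ennreal (u x)) = avg P (\<lambda>x. ennreal (v x))"
    "avg P (\<lambda>x. ennreal (u x powr (1 - conj_exp p))) = avg P (\<lambda>x. ennreal (v x powr (1 - conj_exp p)))" for P
    unfolding avg_def nn_integral_completion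
    by (intro arg_cong2[where f="(/)"] refl nn_integral_cong_AE; use assms in eventually_elim; simp)+
  then show ?thesis unfolding Ap_const_def by simp
qed

text \<open>By \<open>AE_slices\<close>, almost every slice of \<open>w\<close> agrees almost
  everywhere with that of \<open>v\<close>, and the characteristic depends on averages only.
  Completing the product measure does not change which statements hold almost everywhere.\<close>

lemma AE_Ap_const_le_Ap_char_var:
  fixes w v :: "real^'n::finite \<Rightarrow> real"
  assumes "AE x in lborel. w x = v x"
  shows "AE y in others_measure i. Ap_const p (\<lambda>t. v (set_coord i y t)) \<le> Ap_char_var p w i"
proof -
  have "AE y in completion (others_measure i). Ap_const p (\<lambda>t. w (set_coord i y t)) \<le> Ap_char_var p w i"
    unfolding Ap_char_var_def set_coord_def[symmetric] by (rule esssup_AE)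
  then have "AE y in others_measure i. Ap_const p (\<lambda>t. w (set_coord i y t)) \<le> Ap_char_var p w i"
    by (simp only: AE_completion_iff)
  then show ?thesis
    using AE_slices[OF assms, of i]
    by eventually_elim (metis Ap_const_cong_AE)
qed

text \<open>Rules out that \<open>False\<close> holds almost everywhere. In dimension one the
  product is empty and its space is a single point of mass 1.\<close>

lemma emeasure_others_space: "emeasure (others_measure i) (space (others_measure (i::'n::finite))) \<noteq> 0"
proof -
  interpret product_sigma_finite "\<lambda>_::'n. lborel :: real measure" ..
  have "emeasure (others_measure i) (space (others_measure i)) = (\<Prod>j\<in>UNIV - {i}. emeasure (lborel :: real measure) UNIV)"
    unfolding space_PiM by (subst emeasure_PiM) auto
  also have "\<dots> \<noteq> 0" by (simp del: prod_constant)
  finally show ?thesis .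
qed

text \<open>Guarantees that an infinite characteristic in one variable is not cancelled by a factor
  0 in the product. A slice with characteristic 0 would have a vanishing average over
  \<open>{0..1}\<close>, although the weight and its dual are positive.\<close>

lemma Ap_char_var_nonzero:
  fixes w :: "real^'n::finite \<Rightarrow> real"
  assumes p: "1 < p" and "weight w"
  shows "Ap_char_var p w i \<noteq> 0"
proof
  obtain v where [measurable]: "v \<in> borel_measurable borel" and v: "\<And>x. 0 < v x" "AE x in lborel. w x = v x"
    using borel_positive_version[OF \<open>weight w\<close>] by blast
  assume "Ap_char_var p w i = 0"
  then have "AE y in others_measure i. Ap_const p (\<lambda>t. v (set_coord i y t)) = 0"
    using AE_Ap_const_le_Ap_char_var[OF v(2), where i = i and p = p] by simp
  then have "AE y in others_measure i. False"
  proof eventually_elim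
    case (elim y)
    note [measurable] = measurable_set_coord_right[of i y]
    have pw: "positive_weight p (\<lambda>t. v (set_coord i y t))"
      by (rule positive_weight.intro) (use p v elim in auto)
    note fin = positive_weight.interval_finite[OF pw, of 0 1] and le = positive_weight.Ap_interval[OF pw, of 0 1]
    show False using fin le elim by (auto simp: ennreal_divide_eq_0_iff epowr_eq_0_iff)
  qed
  then show False
    using emeasure_others_space[of i] by (simp add: AE_iff_measurable[OF sets.top] )
qed

lemma emeasure_cbox_vec:
  fixes l u :: "real^'n::finite"
  assumes "\<And>i. l $ i \<le> u $ i"
  shows "emeasure lborel (cbox l u) = ennreal (\<Prod>i\<in>UNIV. u $ i - l $ i)"
proof -
  have "emeasure lborel (cbox l u) = ennreal (\<Prod>b\<in>Basis. (u - l) \<bullet> b)"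
    using assms by (intro emeasure_lborel_cbox) (auto simp: inner_axis Basis_vec_def)
  then show ?thesis by (simp add: prod_Basis_vec inner_axis)
qed

lemma emeasure_cbox_vec_nontrivial:
  fixes l u :: "real^'n::finite"
  assumes "\<And>i. l $ i < u $ i"
  shows "emeasure lborel (cbox l u) \<noteq> 0" "emeasure lborel (cbox l u) \<noteq> top"
proof -
  have "0 < (\<Prod>i\<in>UNIV. u $ i - l $ i)"
    using assms by (intro prod_pos) simp
  then show "emeasure lborel (cbox l u) \<noteq> 0" "emeasure lborel (cbox l u) \<noteq> top"
    using emeasure_cbox_vec[of l u] assms by (metis ennreal_eq_0_iff less_imp_le not_le, metis ennreal_neq_top less_imp_le)
qed

lemma strong_maximal_le_foldr:
  fixes f :: "real^'n::finite \<Rightarrow> real" and g :: "real^'n \<Rightarrow> ennreal"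
  assumes [measurable]: "g \<in> borel_measurable borel" and fg: "AE x in lborel. ennreal \<bar>f x\<bar> = g x"
    and L: "set L = UNIV"
  shows "strong_maximal f x \<le> 2 ^ CARD('n) * foldr slice_maximal L g x"
  unfolding strong_maximal_def
proof (rule SUP_least)
  fix P assume "P \<in> {P \<in> parallelepipeds. x \<in> P}"
  then obtain l u where P: "P = cbox l u" "x \<in> cbox l u" and "box l u \<noteq> {}"
    by (auto simp: parallelepipeds_def)
  then have lu: "l $ i < u $ i" for i
    by (auto simp: interval_eq_empty_cart not_le)
  \<comment> \<open>Each end moves outwards by less than half the side length, so each side of the
    rational box is less than twice the original one.\<close>
  have "\<exists>r\<in>\<rat>. l $ i - (u $ i - l $ i) / 2 < r \<and> r < l $ i" for i
    using lu[of i] by (intro Rats_dense_in_real) auto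
  then obtain a where a: "\<And>i. a i \<in> \<rat>" "\<And>i. l $ i - (u $ i - l $ i) / 2 < a i" "\<And>i. a i < l $ i"
    by metis
  have "\<exists>r\<in>\<rat>. u $ i < r \<and> r < u $ i + (u $ i - l $ i) / 2" for i
    using lu[of i] by (intro Rats_dense_in_real) auto
  then obtain b where b: "\<And>i. b i \<in> \<rat>" "\<And>i. b i < u $ i + (u $ i - l $ i) / 2" "\<And>i. u $ i < b i"
    by metis
  have ab: "a i < b i" for i using a(3)[of i] b(3)[of i] lu[of i] by linarith
  let ?Q = "{x. \<forall>i. x $ i \<in> {a i..b i}}"
  let ?T = "foldr slice_maximal L g x"
  have Q: "?Q = cbox (\<chi> i. a i) (\<chi> i. b i)" by (auto simp: mem_box_cart)
  have sub: "cbox l u \<subseteq> ?Q"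
  proof (clarsimp simp: mem_box_cart)
    fix z i assume "\<forall>i. l $ i \<le> z $ i \<and> z $ i \<le> u $ i"
    then show "a i \<le> z $ i \<and> z $ i \<le> b i"
      using a(3)[of i] b(3)[of i] by (metis less_imp_le order_trans)
  qed
  have Qle: "emeasure lborel ?Q \<le> 2 ^ CARD('n) * emeasure lborel (cbox l u)"
  proof -
    have "(\<Prod>i\<in>UNIV. b i - a i) \<le> (\<Prod>i\<in>UNIV. 2 * (u $ i - l $ i))"
    proof (rule prod_mono)
      fix i show "0 \<le> b i - a i \<and> b i - a i \<le> 2 * (u $ i - l $ i)"
        using ab[of i] a(2)[of i] b(2)[of i] by (simp add: field_simps)
    qed
    also have "\<dots> = 2 ^ CARD('n) * (\<Prod>i\<in>UNIV. u $ i - l $ i)"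
      by (subst prod.distrib) simp
    finally have "emeasure lborel ?Q \<le> ennreal (2 ^ CARD('n) * (\<Prod>i\<in>UNIV. u $ i - l $ i))"
      unfolding Q using ab by (subst emeasure_cbox_vec) (auto intro: less_imp_le ennreal_leI)
    also have "\<dots> = 2 ^ CARD('n) * emeasure lborel (cbox l u)"
    proof -
      have "ennreal (2 ^ CARD('n)) = 2 ^ CARD('n)"
        by (metis ennreal_numeral ennreal_power zero_le_numeral)
      moreover have "0 \<le> (\<Prod>i\<in>UNIV. u $ i - l $ i)"
        using lu by (intro prod_nonneg) (auto intro: less_imp_le)
      ultimately show ?thesis
        using lu by (subst emeasure_cbox_vec) (auto intro: less_imp_le simp: ennreal_mult)
    qed
    finally show ?thesis .
  qed
  have "(\<integral>\<^sup>+x\<in>cbox l u. ennreal \<bar>f x\<bar> \<partial>lebesgue) = (\<integral>\<^sup>+x\<in>cbox l u. g x \<partial>lborel)"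
    unfolding nn_integral_completion using fg by (intro nn_integral_cong_AE) auto
  also have "\<dots> \<le> (\<integral>\<^sup>+x\<in>?Q. g x \<partial>lborel)"
    using sub by (intro nn_integral_mono) (auto simp: indicator_def)
  also have "\<dots> \<le> ?T * emeasure lborel ?Q"
    using a b ab P(2) sub L by (intro avg_le_foldr_slice_maximal) (auto simp: rat_intervals_def)
  also have "\<dots> \<le> ?T * (2 ^ CARD('n) * emeasure lborel (cbox l u))"
    by (intro mult_left_mono Qle) simp
  also have "\<dots> = 2 ^ CARD('n) * ?T * emeasure lborel (cbox l u)"
    by (simp only: ac_simps)
  finally have "(\<integral>\<^sup>+x\<in>cbox l u. ennreal \<bar>f x\<bar> \<partial>lebesgue) \<le> 2 ^ CARD('n) * ?T * emeasure lborel (cbox l u)" .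
  moreover have "emeasure lborel (cbox l u) \<noteq> 0" "emeasure lborel (cbox l u) \<noteq> top"
    using emeasure_cbox_vec_nontrivial[OF lu] by auto
  ultimately show "avg P (\<lambda>y. ennreal \<bar>f y\<bar>) \<le> 2 ^ CARD('n) * ?T"
    using divide_right_mono_ennreal[of _ "2 ^ CARD('n) * ?T * emeasure lborel (cbox l u)" "emeasure lborel (cbox l u)"]
    by (simp add: avg_def P mult_divide_eq_ennreal)
qed

theorem strong_maximal_bound:
  fixes w f :: "real^'n::finite \<Rightarrow> real"
  assumes p: "1 < p" and w: "weight w" and f: "f \<in> borel_measurable lebesgue"
  defines "K \<equiv> maximal_const (conj_exp p) * maximal_const p"
  shows "lpw_norm p w (strong_maximal f)
    \<le> ennreal (2 ^ CARD('n) * (K ^ CARD('n)) powr (1 / p)) * epowr (Ap_char_prod p w) (1 / (p - 1))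
       * lpw_norm p w (\<lambda>x. ennreal \<bar>f x\<bar>)"
proof -
  have K: "0 < K" using p conj_exp_simps(1)[OF p] by (simp add: K_def maximal_const_def)
  obtain v where [measurable]: "v \<in> borel_measurable borel" and v: "\<And>x. 0 < v x" "AE x in lborel. w x = v x"
    using borel_positive_version[OF w] by blast
  obtain g where [measurable]: "g \<in> borel_measurable borel" and g: "AE x in lborel. ennreal \<bar>f x\<bar> = g x"
    using completion_ex_borel_measurable[of "\<lambda>x. ennreal \<bar>f x\<bar>" lborel] f by auto
  obtain L :: "'n list" where L: "set L = UNIV" "distinct L"
    using finite_distinct_list[OF finite] by blast
  then have len: "length L = CARD('n)" using distinct_card by fastforce
  let ?T = "foldr slice_maximal L g"
  let ?I = "\<integral>\<^sup>+x. epowr (g x) p * ennreal (v x) \<partial>lborel"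
  have I: "lpw_norm p w (\<lambda>x. ennreal \<bar>f x\<bar>) = epowr ?I (1 / p)"
    unfolding lpw_norm_def nn_integral_completion
    by (intro arg_cong2[where f=epowr] nn_integral_cong_AE refl, use v(2) g in eventually_elim) simp
  \<comment> \<open>Since \<open>0 * top = 0\<close>, an infinite characteristic makes the
    right-hand side infinite only if the norm of \<open>f\<close> is nonzero. The case
    \<open>f = 0\<close> almost everywhere is therefore separate; there all averages vanish.\<close>
  consider "?I = 0" | "?I \<noteq> 0" "\<exists>i. Ap_char_var p w i = top" | "\<And>i. Ap_char_var p w i < top"
    by (metis top.not_eq_extremum)
  then show ?thesis
  proof cases
    case 1
    then have "AE x in lborel. epowr (g x) p * ennreal (v x) = 0"
      by (subst (asm) nn_integral_0_iff_AE) auto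
    then have "AE x in lborel. g x = 0"
    proof eventually_elim
      case (elim x)
      then show ?case using v(1)[of x] by (simp add: ennreal_eq_0_iff epowr_eq_0_iff)
    qed
    with g have f0: "AE x in lborel. ennreal \<bar>f x\<bar> = 0" by eventually_elim simp
    have "avg P (\<lambda>y. ennreal \<bar>f y\<bar>) = 0" for P
    proof -
      have "(\<integral>\<^sup>+x\<in>P. ennreal \<bar>f x\<bar> \<partial>lborel) = (\<integral>\<^sup>+x. 0 \<partial>(lborel :: (real^'n) measure))"
        by (intro nn_integral_cong_AE, use f0 in eventually_elim) auto
      then show ?thesis by (simp add: avg_def nn_integral_completion)
    qed
    then have "strong_maximal f x \<le> 0" for x
      unfolding strong_maximal_def by (intro SUP_least) simp
    then show ?thesis by (simp add: lpw_norm_def)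
  next
    case 2
    then have "Ap_char_prod p w = top"
      unfolding Ap_char_prod_def using Ap_char_var_nonzero[OF p w]
      by (auto simp: ennreal_prod_eq_top)
    moreover have "epowr ?I (1 / p) \<noteq> 0"
      using 2(1) by (simp add: epowr_eq_0_iff)
    ultimately show ?thesis
      unfolding I using K by (simp add: ennreal_mult_eq_top_iff ennreal_mult_top ennreal_top_mult)
  next
    case 3
    have "(\<integral>\<^sup>+x. epowr (strong_maximal f x) p * ennreal (w x) \<partial>lebesgue)
      \<le> (\<integral>\<^sup>+x. ennreal ((2 ^ CARD('n)) powr p) * (epowr (?T x) p * ennreal (v x)) \<partial>lborel)"
      unfolding nn_integral_completion
    proof (rule nn_integral_mono_AE, use v(2) in eventually_elim)
      case (elim x)
      have "epowr (strong_maximal f x) p \<le> epowr (2 ^ CARD('n) * ?T x) p"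
        using p by (intro epowr_mono strong_maximal_le_foldr g L) auto
      also have "\<dots> = ennreal ((2 ^ CARD('n)) powr p) * epowr (?T x) p"
        using p epowr_ennreal[of "2 ^ CARD('n)" p] by (simp add: epowr_mult flip: ennreal_power)
      finally show ?case by (simp add: elim mult_right_mono flip: mult.assoc)
    qed
    also have "\<dots> = ennreal ((2 ^ CARD('n)) powr p) * (\<integral>\<^sup>+x. epowr (?T x) p * ennreal (v x) \<partial>lborel)"
      by (rule nn_integral_cmult) simp
    also have "\<dots> \<le> ennreal ((2 ^ CARD('n)) powr p)
        * (ennreal K ^ length L * epowr (\<Prod>i\<in>set L. Ap_char_var p w i) (conj_exp p) * ?I)"
      unfolding K_def using p v AE_Ap_const_le_Ap_char_var[OF v(2)] 3 L
      by (intro mult_left_mono foldr_slice_maximal_bound) auto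
    finally have "lpw_norm p w (strong_maximal f) \<le> epowr (ennreal ((2 ^ CARD('n)) powr p)
        * (ennreal K ^ length L * epowr (\<Prod>i\<in>set L. Ap_char_var p w i) (conj_exp p) * ?I)) (1 / p)"
      unfolding lpw_norm_def using p by (intro epowr_mono) auto
    \<comment> \<open>The p-th root turns the exponent \<open>conj_exp p\<close> into
      \<open>1 / (p - 1)\<close>; the factor \<open>2 ^ CARD('n)\<close> stems from the rational
      boxes, \<open>K ^ CARD('n)\<close> from the \<open>n\<close> directions.\<close>
    also have "\<dots> = ennreal (2 ^ CARD('n)) * ennreal ((K ^ CARD('n)) powr (1 / p))
        * epowr (Ap_char_prod p w) (1 / (p - 1)) * epowr ?I (1 / p)"
      using p K by (simp add: epowr_mult epowr_epowr epowr_ennreal ennreal_power len L powr_powr conj_exp_def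
          Ap_char_prod_def mult.assoc del: power_one_right)
    finally show ?thesis
      unfolding I by (simp add: ennreal_mult)
  qed
qed

subsection \<open>Sharpness of the exponent\<close>

definition pow_weight :: "real \<Rightarrow> real \<Rightarrow> real" where
  "pow_weight \<alpha> t = (if t = 0 then 1 else \<bar>t\<bar> powr \<alpha>)"

text \<open>This is the reason for the value 1 at 0, where \<open>0 powr \<alpha>\<close> would be
  0: frozen at any \<open>x $ k\<close>, the weight has to be a positive constant on lines in the
  other directions.\<close>

lemma pow_weight_pos: "0 < pow_weight \<alpha> t"
  by (simp add: pow_weight_def)

lemma borel_measurable_pow_weight [measurable]: "pow_weight \<alpha> \<in> borel_measurable borel"
  unfolding pow_weight_def[abs_def] by measurable

lemma nn_integral_abs_powr:
  assumes "0 < d" "0 \<le> R"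
  shows "(\<integral>\<^sup>+t\<in>{-R..R}. ennreal (\<bar>t\<bar> powr (d - 1)) \<partial>lborel) \<le> ennreal (2 * R powr d / d)"
proof -
  let ?h = "\<lambda>t. ennreal (t powr (d - 1)) * indicator {0<..<R} t"
  have h: "(\<integral>\<^sup>+t. ?h t \<partial>lborel) = ennreal (R powr d / d)"
    using nn_integral_powr[OF assms] .
  have "(\<integral>\<^sup>+t. ?h t \<partial>lborel) = (\<integral>\<^sup>+t. ?h (- t) \<partial>lborel)"
    using nn_integral_real_affine[of ?h "-1" 0] by simp
  with h have h': "(\<integral>\<^sup>+t. ?h (- t) \<partial>lborel) = ennreal (R powr d / d)" by simp
  have "AE t::real in lborel. t \<noteq> 0 \<and> t \<noteq> R \<and> t \<noteq> - R"
    using AE_lborel_singleton[of 0] AE_lborel_singleton[of R] AE_lborel_singleton[of "- R"]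
    by eventually_elim simp
  then have "(\<integral>\<^sup>+t\<in>{-R..R}. ennreal (\<bar>t\<bar> powr (d - 1)) \<partial>lborel) \<le> (\<integral>\<^sup>+t. ?h t + ?h (- t) \<partial>lborel)"
    by (intro nn_integral_mono_AE, eventually_elim) (auto simp: indicator_def)
  also have "\<dots> = (\<integral>\<^sup>+t. ?h t \<partial>lborel) + (\<integral>\<^sup>+t. ?h (- t) \<partial>lborel)"
    by (rule nn_integral_add) measurable
  also have "\<dots> = ennreal (2 * R powr d / d)"
    unfolding h h' using assms by (simp flip: ennreal_plus)
  finally show ?thesis .
qed

lemma avg_le:
  assumes "a < b" and "AE t in lborel. t \<in> {a..b} \<longrightarrow> g t \<le> c"
  shows "avg {a..b::real} g \<le> c"
proof -
  have "(\<integral>\<^sup>+t\<in>{a..b}. g t \<partial>lborel) \<le> (\<integral>\<^sup>+t. c * indicator {a..b} t \<partial>lborel)"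
    by (intro nn_integral_mono_AE, use assms(2) in eventually_elim) (auto simp: indicator_def)
  also have "\<dots> = c * ennreal (b - a)"
    using assms(1) by (simp add: nn_integral_cmult_indicator)
  finally have "avg {a..b} g \<le> c * ennreal (b - a) / ennreal (b - a)"
    unfolding avg_Icc[OF assms(1)] by (rule divide_right_mono_ennreal)
  also have "\<dots> = c"
    using assms(1) by (intro mult_divide_eq_ennreal) auto
  finally show ?thesis .
qed

text \<open>An interval of length at least \<open>R / 2\<close> is compared with
  \<open>{-R..R}\<close>; a shorter one stays at distance at least \<open>R / 2\<close> from 0, so
  the integrand is at most a multiple of \<open>R^(d-1)\<close>. Only the first case produces the
  factor \<open>1 / d\<close>.\<close>

lemma avg_abs_powr_le:
  fixes a b d :: real
  assumes "0 < d" "d < 1" "a < b"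
  defines "R \<equiv> max \<bar>a\<bar> \<bar>b\<bar>"
  shows "avg {a..b} (\<lambda>t. ennreal (\<bar>t\<bar> powr (d - 1))) \<le> ennreal (4 / d * R powr (d - 1))"
proof (cases "R / 2 \<le> b - a")
  case True
  have R: "0 < R" using assms by (auto simp: R_def)
  have "(\<integral>\<^sup>+t\<in>{a..b}. ennreal (\<bar>t\<bar> powr (d - 1)) \<partial>lborel)
      \<le> (\<integral>\<^sup>+t\<in>{-R..R}. ennreal (\<bar>t\<bar> powr (d - 1)) \<partial>lborel)"
    by (intro nn_integral_mono) (auto simp: indicator_def R_def)
  also have "\<dots> \<le> ennreal (2 * R powr d / d)"
    using assms R by (intro nn_integral_abs_powr) auto
  finally have "avg {a..b} (\<lambda>t. ennreal (\<bar>t\<bar> powr (d - 1))) \<le> ennreal (2 * R powr d / d) / ennreal (b - a)"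
    unfolding avg_Icc[OF \<open>a < b\<close>] by (rule divide_right_mono_ennreal)
  also have "\<dots> = ennreal (2 * R powr d / d / (b - a))"
    using assms by (intro divide_ennreal) auto
  also have "\<dots> \<le> ennreal (2 * R powr d / d / (R / 2))"
    using True R assms by (intro ennreal_leI divide_left_mono) auto
  also have "2 * R powr d / d / (R / 2) = 4 / d * R powr (d - 1)"
    using R by (simp add: powr_diff)
  finally show ?thesis .
next
  case False
  have R: "0 < R" using assms by (auto simp: R_def)
  show ?thesis
  proof (rule avg_le[OF \<open>a < b\<close>], rule AE_I2, rule impI, rule ennreal_leI)
    fix t assume "t \<in> {a..b}"
    then have t: "R / 2 \<le> \<bar>t\<bar>" using False unfolding R_def by (auto simp: max_def split: if_splits)
    have "\<bar>t\<bar> powr (d - 1) \<le> (R / 2) powr (d - 1)"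
      using t R assms by (intro powr_mono2') auto
    also have "\<dots> = 2 powr (1 - d) * R powr (d - 1)"
      using R by (simp add: powr_divide powr_diff)
    also have "\<dots> \<le> 4 / d * R powr (d - 1)"
    proof (rule mult_right_mono)
      have "2 powr (1 - d) \<le> 2 powr (1::real)" using assms by (intro powr_mono) auto
      also have "\<dots> \<le> 4 / d" using assms by (simp add: field_simps)
      finally show "2 powr (1 - d) \<le> 4 / d" .
    qed simp
    finally show "\<bar>t\<bar> powr (d - 1) \<le> 4 / d * R powr (d - 1)" .
  qed
qed

lemma avg_Icc_0_powr:
  assumes "0 < e" "0 < s"
  shows "avg {0..s} (\<lambda>t. ennreal (\<bar>t\<bar> powr (e - 1))) = ennreal (s powr (e - 1) / e)"
proof -
  have "AE t::real in lborel. t \<noteq> 0 \<and> t \<noteq> s"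
    using AE_lborel_singleton[of 0] AE_lborel_singleton[of s] by eventually_elim simp
  then have "(\<integral>\<^sup>+t\<in>{0..s}. ennreal (\<bar>t\<bar> powr (e - 1)) \<partial>lborel) = (\<integral>\<^sup>+t\<in>{0<..<s}. ennreal (t powr (e - 1)) \<partial>lborel)"
    by (intro nn_integral_cong_AE, eventually_elim) (auto simp: indicator_def)
  also have "\<dots> = ennreal (s powr e / e)"
    using assms by (intro nn_integral_powr) auto
  finally have "avg {0..s} (\<lambda>t. ennreal (\<bar>t\<bar> powr (e - 1))) = ennreal (s powr e / e) / ennreal s"
    using avg_Icc[OF assms(2)] by simp
  also have "\<dots> = ennreal (s powr e / e / s)"
    using assms by (intro divide_ennreal) auto
  also have "s powr e / e / s = s powr (e - 1) / e"
    using assms by (simp add: powr_diff)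
  finally show ?thesis .
qed

context
  fixes p d \<alpha> :: real
  assumes p: "1 < p" and d: "0 < d" "d < 1"
  defines "\<alpha> \<equiv> (p - 1) * (1 - d)"
begin

text \<open>\<open>\<alpha>\<close> is chosen so that \<open>\<alpha> * (1 - p') = d - 1\<close>,
  just inside the range of local integrability. At 0 the two sides are 1 and 0.\<close>

lemma dual_pow_weight: "t \<noteq> 0 \<Longrightarrow> pow_weight \<alpha> t powr (1 - conj_exp p) = \<bar>t\<bar> powr (d - 1)"
  using conj_exp_simps(3)[OF p] p by (simp add: pow_weight_def powr_powr \<alpha>_def)

lemma avg_dual_pow_weight:
  assumes "a < b"
  shows "avg {a..b} (\<lambda>t. ennreal (pow_weight \<alpha> t powr (1 - conj_exp p)))
    = avg {a..b} (\<lambda>t. ennreal (\<bar>t\<bar> powr (d - 1)))"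
  unfolding avg_Icc[OF assms]
  by (intro arg_cong2[where f="(/)"] refl nn_integral_cong_AE,
      use AE_lborel_singleton[of "0::real"] in eventually_elim) (simp add: dual_pow_weight)

text \<open>With \<open>R\<close> the largest modulus on the interval, the weight averages to at
  most \<open>R^\<alpha>\<close> and its dual to at most \<open>4 / d * R^(d-1)\<close>. The powers
  of \<open>R\<close> cancel, reflecting dilation invariance.\<close>

lemma Ap_const_pow_weight_le: "Ap_const p (pow_weight \<alpha>) \<le> ennreal ((4 / d) powr (p - 1))"
  unfolding Ap_const_def
proof (rule SUP_least)
  fix P :: "real set" assume "P \<in> parallelepipeds"
  then obtain a b where P: "P = {a..b}" "a < b" using real_parallelepiped_iff by blast
  define R where "R = max \<bar>a\<bar> \<bar>b\<bar>"
  have R: "0 < R" using P by (auto simp: R_def)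
  have 1: "avg {a..b} (\<lambda>x. ennreal (pow_weight \<alpha> x)) \<le> ennreal (R powr \<alpha>)"
  proof (rule avg_le[OF P(2)], use AE_lborel_singleton[of "0::real"] in eventually_elim, rule impI)
    fix t :: real assume "t \<noteq> 0" "t \<in> {a..b}"
    then show "ennreal (pow_weight \<alpha> t) \<le> ennreal (R powr \<alpha>)"
      using p d by (auto simp: pow_weight_def \<alpha>_def R_def intro!: ennreal_leI powr_mono2)
  qed
  have "epowr (avg {a..b} (\<lambda>x. ennreal (pow_weight \<alpha> x powr (1 - conj_exp p)))) (p - 1)
      \<le> epowr (ennreal (4 / d * R powr (d - 1))) (p - 1)"
    unfolding avg_dual_pow_weight[OF P(2)] R_def using p d P(2)
    by (intro epowr_mono avg_abs_powr_le) auto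
  also have "\<dots> = ennreal ((4 / d * R powr (d - 1)) powr (p - 1))"
    using d by (simp add: epowr_ennreal)
  finally have "avg {a..b} (\<lambda>x. ennreal (pow_weight \<alpha> x)) *
      epowr (avg {a..b} (\<lambda>x. ennreal (pow_weight \<alpha> x powr (1 - conj_exp p)))) (p - 1)
    \<le> ennreal (R powr \<alpha>) * ennreal ((4 / d * R powr (d - 1)) powr (p - 1))"
    using 1 by (intro mult_mono) auto
  also have "\<dots> = ennreal (R powr \<alpha> * (4 / d * R powr (d - 1)) powr (p - 1))"
    by (simp add: ennreal_mult)
  also have "R powr \<alpha> * (4 / d * R powr (d - 1)) powr (p - 1) = (4 / d) powr (p - 1)"
  proof -
    have "(4 / d * R powr (d - 1)) powr (p - 1) = (4 / d) powr (p - 1) * R powr ((d - 1) * (p - 1))"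
      by (subst powr_mult) (use d in \<open>auto simp: powr_powr\<close>)
    moreover have "R powr \<alpha> * R powr ((d - 1) * (p - 1)) = 1"
      using R by (simp add: \<alpha>_def algebra_simps flip: powr_add)
    ultimately show ?thesis by (simp add: ac_simps)
  qed
  finally show "avg P (\<lambda>x. ennreal (pow_weight \<alpha> x)) *
      epowr (avg P (\<lambda>x. ennreal (pow_weight \<alpha> x powr (1 - conj_exp p)))) (p - 1)
    \<le> ennreal ((4 / d) powr (p - 1))" unfolding P .
qed

text \<open>Test interval \<open>{0..1}\<close>, where the two averages are
  \<open>1 / (\<alpha> + 1)\<close> and \<open>1 / d\<close>. For small \<open>d\<close> this places
  the characteristic in \<open>[1, \<infinity>)\<close>, the range where \<open>\<psi>\<close> is
  monotone.\<close>

lemma Ap_const_pow_weight_ge: "ennreal ((1 / d) powr (p - 1) / p) \<le> Ap_const p (pow_weight \<alpha>)"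
proof -
  have a: "0 \<le> \<alpha>" "\<alpha> + 1 \<le> p"
  proof -
    show "0 \<le> \<alpha>" using p d by (simp add: \<alpha>_def)
    have "(p - 1) * (1 - d) \<le> (p - 1) * 1" using p d by (intro mult_left_mono) auto
    then show "\<alpha> + 1 \<le> p" by (simp add: \<alpha>_def)
  qed
  have "avg {0..1} (\<lambda>x. ennreal (pow_weight \<alpha> x)) = avg {0..1} (\<lambda>t. ennreal (\<bar>t\<bar> powr ((\<alpha> + 1) - 1)))"
    unfolding avg_Icc[OF zero_less_one]
    by (intro arg_cong2[where f="(/)"] refl nn_integral_cong_AE,
        use AE_lborel_singleton[of "0::real"] in eventually_elim) (simp add: pow_weight_def)
  also have "\<dots> = ennreal (1 powr (\<alpha> + 1 - 1) / (\<alpha> + 1))"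
    using a by (intro avg_Icc_0_powr) auto
  finally have 1: "ennreal (1 / p) \<le> avg {0..1} (\<lambda>x. ennreal (pow_weight \<alpha> x))"
    using a by (simp add: frac_le)
  have 2: "epowr (avg {0..1} (\<lambda>x. ennreal (pow_weight \<alpha> x powr (1 - conj_exp p)))) (p - 1)
      = ennreal ((1 / d) powr (p - 1))"
    using d avg_Icc_0_powr[of d 1] by (simp add: avg_dual_pow_weight epowr_ennreal)
  have "ennreal ((1 / d) powr (p - 1) / p) = ennreal (1 / p) * ennreal ((1 / d) powr (p - 1))"
    using p by (simp flip: ennreal_mult)
  also have "\<dots> \<le> avg {0..1} (\<lambda>x. ennreal (pow_weight \<alpha> x)) *
      epowr (avg {0..1} (\<lambda>x. ennreal (pow_weight \<alpha> x powr (1 - conj_exp p)))) (p - 1)"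
    unfolding 2 using 1 by (intro mult_right_mono) auto
  also have "\<dots> \<le> Ap_const p (pow_weight \<alpha>)"
    unfolding Ap_const_def by (rule SUP_upper) (use real_parallelepiped_iff zero_less_one in blast)
  finally show ?thesis .
qed

end

section \<open>Weights depending on a single coordinate\<close>

lemma Ap_const_constant:
  assumes "1 < p" "0 < c"
  shows "Ap_const p (\<lambda>_::real. c) = 1"
proof -
  have avg: "avg {a..b::real} (\<lambda>_. ennreal e) = ennreal e" if "a < b" for a b e
  proof -
    have "(\<integral>\<^sup>+t\<in>{a..b}. ennreal e \<partial>lborel) = ennreal e * ennreal (b - a)"
      using that by (simp add: nn_integral_cmult_indicator)
    then show ?thesis
      using that mult_divide_eq_ennreal[of "ennreal (b - a)" "ennreal e"] by (simp add: avg_Icc)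
  qed
  have "avg P (\<lambda>_. ennreal c) * epowr (avg P (\<lambda>_. ennreal (c powr (1 - conj_exp p)))) (p - 1) = 1"
    if Pp: "P \<in> parallelepipeds" for P :: "real set"
  proof -
    obtain a b where P: "P = {a..b}" "a < b" using Pp real_parallelepiped_iff by blast
    have "(1 - conj_exp p) * (p - 1) = - 1" using assms(1) by (simp add: conj_exp_simps(3))
    then have "c * (c powr (1 - conj_exp p)) powr (p - 1) = 1"
      using assms by (simp add: powr_powr powr_minus)
    then show ?thesis
      using assms(2) P by (simp add: avg epowr_ennreal flip: ennreal_mult)
  qed
  then have "Ap_const p (\<lambda>_::real. c) = (SUP P\<in>(parallelepipeds :: real set set). 1)"
    unfolding Ap_const_def by (intro SUP_cong) auto
  moreover have "(parallelepipeds :: real set set) \<noteq> {}"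
    using real_parallelepiped_iff[of "{0..1}"] zero_less_one by blast
  ultimately show ?thesis by simp
qed

text \<open>The cross-section contributes the same factor \<open>C\<close> to the integral and to
  the volume. It cancels, being neither 0 nor infinite because the box has positive finite
  measure.\<close>

lemma avg_cbox_coord:
  fixes l u :: "real^'n::finite"
  assumes [measurable]: "h \<in> borel_measurable borel" and lu: "\<And>i. l $ i < u $ i"
  shows "avg (cbox l u) (\<lambda>x. h (x $ k)) = avg {l $ k..u $ k} h"
proof -
  define R where "R = {y. \<forall>j. j \<noteq> k \<longrightarrow> y j \<in> {l $ j..u $ j}}"
  define C where "C = (\<integral>\<^sup>+y. indicator R y \<partial>others_measure k)"
  have ind: "indicator (cbox l u) (set_coord k y t) = (indicator R y * indicator {l $ k..u $ k} t :: ennreal)" for y t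
    by (auto simp: R_def indicator_def mem_box_cart)
  have R: "(\<lambda>y. indicator R y :: ennreal) \<in> borel_measurable (others_measure k)"
  proof -
    have "(\<lambda>y. indicator R y :: ennreal) = (\<lambda>y. \<Prod>j\<in>UNIV - {k}. indicator {l $ j..u $ j} (y j))"
      by (auto simp: R_def indicator_def fun_eq_iff)
    then show ?thesis by simp
  qed
  have int: "(\<integral>\<^sup>+x\<in>cbox l u. g (x $ k) \<partial>lborel) = C * (\<integral>\<^sup>+t\<in>{l $ k..u $ k}. g t \<partial>lborel)"
    if [measurable]: "g \<in> borel_measurable borel" for g :: "real \<Rightarrow> ennreal"
  proof -
    have "(\<integral>\<^sup>+x\<in>cbox l u. g (x $ k) \<partial>lborel)
      = (\<integral>\<^sup>+y. \<integral>\<^sup>+t. g (set_coord k y t $ k) * indicator (cbox l u) (set_coord k y t) \<partial>lborel \<partial>others_measure k)"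
      by (rule nn_integral_slices) measurable
    also have "\<dots> = (\<integral>\<^sup>+y. \<integral>\<^sup>+t. indicator R y * (g t * indicator {l $ k..u $ k} t) \<partial>lborel \<partial>others_measure k)"
      by (intro nn_integral_cong) (simp add: ind ac_simps)
    also have "\<dots> = (\<integral>\<^sup>+y. indicator R y * (\<integral>\<^sup>+t\<in>{l $ k..u $ k}. g t \<partial>lborel) \<partial>others_measure k)"
      by (intro nn_integral_cong nn_integral_cmult) measurable
    also have "\<dots> = C * (\<integral>\<^sup>+t\<in>{l $ k..u $ k}. g t \<partial>lborel)"
      unfolding C_def by (rule nn_integral_multc[OF R])
    finally show ?thesis .
  qed
  have E: "emeasure lborel (cbox l u) = C * emeasure lborel {l $ k..u $ k}"
    using int[of "\<lambda>_. 1"] by simp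
  have E': "emeasure lborel (cbox l u) \<noteq> 0" "emeasure lborel (cbox l u) \<noteq> top"
    using emeasure_cbox_vec_nontrivial[OF lu] by auto
  have L: "emeasure lborel {l $ k..u $ k} \<noteq> 0" "emeasure lborel {l $ k..u $ k} \<noteq> top"
    using lu[of k] by auto
  have C: "C \<noteq> 0" "C \<noteq> top" using E E' L by (auto simp: ennreal_top_mult)
  let ?I = "\<integral>\<^sup>+t\<in>{l $ k..u $ k}. h t \<partial>lborel" and ?E = "emeasure lborel {l $ k..u $ k}"
  have "?I / ?E = C * ?I / (C * ?E)"
  proof -
    have "(?I / ?E) * (C * ?E) = C * (?I / ?E * ?E)" by (simp only: ac_simps)
    also have "\<dots> = C * ?I" by (subst ennreal_divide_mult_cancel[OF L]) (rule refl)
    finally show ?thesis using E E' mult_divide_eq_ennreal[of "C * ?E" "?I / ?E"] by metis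
  qed
  then show ?thesis
    using lu[of k] unfolding avg_def nn_integral_completion by (simp add: int E)
qed

lemma lpw_norm_mono:
  assumes "0 < p" "\<And>x. g x \<le> h x"
  shows "lpw_norm p w g \<le> lpw_norm p w h"
  unfolding lpw_norm_def using assms
  by (intro epowr_mono nn_integral_mono mult_right_mono) auto

lemma lpw_norm_cmult:
  assumes "0 < p" and [measurable]: "g \<in> borel_measurable lebesgue" "w \<in> borel_measurable lebesgue"
  shows "lpw_norm p w (\<lambda>x. c * g x) = c * lpw_norm p w g"
proof -
  have "(\<integral>\<^sup>+x. epowr (c * g x) p * ennreal (w x) \<partial>lebesgue) = epowr c p * (\<integral>\<^sup>+x. epowr (g x) p * ennreal (w x) \<partial>lebesgue)"
    using assms(1) by (subst nn_integral_cmult[symmetric]) (auto simp: epowr_mult mult.assoc)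
  then show ?thesis
    using assms(1) by (simp add: lpw_norm_def epowr_mult epowr_epowr)
qed

definition coord_weight :: "'n \<Rightarrow> real \<Rightarrow> real^'n::finite \<Rightarrow> real" where
  "coord_weight k \<alpha> x = pow_weight \<alpha> (x $ k)"

lemma borel_measurable_coord_weight [measurable]: "coord_weight k \<alpha> \<in> borel_measurable borel"
  unfolding coord_weight_def[abs_def] by measurable

lemma weight_coord_weight:
  assumes "0 \<le> \<alpha>"
  shows "weight (coord_weight k \<alpha> :: real^'n::finite \<Rightarrow> real)"
  unfolding weight_def
proof (intro conjI allI impI)
  show "AE x in lebesgue. 0 < (coord_weight k \<alpha> :: real^'n \<Rightarrow> real) x"
    by (simp add: coord_weight_def pow_weight_pos)
  fix K :: "(real^'n) set" assume K: "compact K"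
  obtain B where B: "\<And>x. x \<in> K \<Longrightarrow> norm x \<le> B"
    using compact_imp_bounded[OF K] by (auto simp: bounded_iff)
  have "norm (coord_weight k \<alpha> x) \<le> max 1 (B powr \<alpha>)" if "x \<in> K" for x
  proof -
    have "\<bar>x $ k\<bar> \<le> B" using component_le_norm_cart[of x k] B[OF that] by linarith
    then have "\<bar>x $ k\<bar> powr \<alpha> \<le> B powr \<alpha>" using assms by (intro powr_mono2) auto
    then show ?thesis by (auto simp: coord_weight_def pow_weight_def)
  qed
  moreover have "emeasure lebesgue K < \<infinity>"
    using emeasure_bounded_finite[OF compact_imp_bounded[OF K]] by (auto simp: compact_imp_closed K)
  ultimately show "set_integrable lebesgue K (coord_weight k \<alpha>)"
    unfolding set_integrable_def using K
    by (intro integrableI_bounded_set_indicator[where B="max 1 (B powr \<alpha>)"])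
      (auto simp: compact_imp_closed measurable_completion)
qed

text \<open>Box averages of the weight and its dual reduce to averages over the k-th side. This puts
  the weight into \<open>Ap_strong p\<close>.\<close>

lemma Ap_const_coord_weight_le:
  "Ap_const p (coord_weight k \<alpha> :: real^'n::finite \<Rightarrow> real) \<le> Ap_const p (pow_weight \<alpha>)"
proof -
  have "avg P (\<lambda>x. ennreal (coord_weight k \<alpha> x))
      * epowr (avg P (\<lambda>x. ennreal (coord_weight k \<alpha> x powr (1 - conj_exp p)))) (p - 1)
    \<le> Ap_const p (pow_weight \<alpha>)" if Pp: "P \<in> parallelepipeds" for P :: "(real^'n) set"
  proof -
    obtain l u where P: "P = cbox l u" and ne: "box l u \<noteq> {}"
      using Pp by (auto simp: parallelepipeds_def)
    then have lu: "\<And>i. l $ i < u $ i" by (auto simp: interval_eq_empty_cart not_le)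
    have 1: "avg P (\<lambda>x. ennreal (coord_weight k \<alpha> x)) = avg {l $ k..u $ k} (\<lambda>t. ennreal (pow_weight \<alpha> t))"
      unfolding P coord_weight_def by (rule avg_cbox_coord[OF _ lu]) measurable
    have 2: "avg P (\<lambda>x. ennreal (coord_weight k \<alpha> x powr (1 - conj_exp p)))
        = avg {l $ k..u $ k} (\<lambda>t. ennreal (pow_weight \<alpha> t powr (1 - conj_exp p)))"
      unfolding P coord_weight_def by (rule avg_cbox_coord[OF _ lu]) measurable
    show ?thesis
      unfolding 1 2 Ap_const_def by (rule SUP_upper) (use lu[of k] real_parallelepiped_iff in blast)
  qed
  then show ?thesis
    unfolding Ap_const_def[of p "coord_weight k \<alpha>"] by (rule SUP_least)
qed

lemma Ap_char_prod_coord_weight: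
  assumes "1 < p"
  shows "Ap_char_prod p (coord_weight k \<alpha> :: real^'n::finite \<Rightarrow> real) = Ap_const p (pow_weight \<alpha>)"
proof -
  let ?w = "coord_weight k \<alpha> :: real^'n \<Rightarrow> real"
  have sp: "emeasure (completion (others_measure i)) (space (completion (others_measure i))) \<noteq> 0" for i :: 'n
    using emeasure_others_space[of i] by simp
  have "Ap_char_var p ?w i = (if i = k then Ap_const p (pow_weight \<alpha>) else 1)" for i
  proof -
    have eq: "Ap_const p (\<lambda>t. ?w (\<chi> j. if j = i then t else y j))
        = (if i = k then Ap_const p (pow_weight \<alpha>) else 1)" for y
      using assms Ap_const_constant[OF assms pow_weight_pos]
      by (auto simp: coord_weight_def)
    show ?thesis
      unfolding Ap_char_var_def eq by (rule esssup_const[OF sp])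
  qed
  then show ?thesis by (simp add: Ap_char_prod_def prod.delta)
qed

text \<open>On the cube, f is the dual weight \<open>x_k^(d-1)\<close>, so
  \<open>f^p * w = f\<close> and the p-th power of its norm is \<open>1 / d\<close>. The average of
  \<open>t^(d-1)\<close> over \<open>{0..s}\<close> is \<open>1 / d\<close> times its value at
  \<open>s\<close>, which is the gain.\<close>

lemma strong_maximal_extremizer:
  fixes p d :: real and k :: "'n::finite"
  assumes p: "1 < p" and d: "0 < d" "d < 1"
  defines "w \<equiv> coord_weight k ((p - 1) * (1 - d)) :: real^'n \<Rightarrow> real"
  shows "\<exists>f\<in>Lpw p w. lpw_norm p w (\<lambda>x. ennreal \<bar>f x\<bar>) \<noteq> 0 \<and>
    ennreal (1 / d) * lpw_norm p w (\<lambda>x. ennreal \<bar>f x\<bar>) \<le> lpw_norm p w (strong_maximal f)"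
proof (intro bexI conjI)
  define f where "f = (\<lambda>x::real^'n. indicator (cbox 0 1) x * (x $ k) powr (d - 1))"
  have f_borel [measurable]: "f \<in> borel_measurable borel"
    unfolding f_def by measurable
  have f_leb [measurable]: "f \<in> borel_measurable lebesgue"
    using measurable_completion[of f lborel borel] by simp
  have w_leb [measurable]: "w \<in> borel_measurable lebesgue"
    using measurable_completion[of w lborel borel] by (simp add: w_def)
  have Q: "emeasure lborel (cbox 0 (1::real^'n)) = 1"
    by (subst emeasure_cbox_vec) auto
  have "(\<integral>\<^sup>+x. epowr (ennreal \<bar>f x\<bar>) p * ennreal (w x) \<partial>lebesgue)
      = avg (cbox 0 1) (\<lambda>x::real^'n. ennreal (\<bar>x $ k\<bar> powr (d - 1)))"
  proof -
    have "epowr (ennreal \<bar>f x\<bar>) p * ennreal (w x) = ennreal (\<bar>x $ k\<bar> powr (d - 1)) * indicator (cbox 0 1) x" for x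
    \<comment> \<open>For \<open>x $ k = 0\<close> both sides vanish, because
      \<open>0 powr (d - 1)\<close> is 0.\<close>
    proof (cases "x \<in> cbox 0 1 \<and> x $ k \<noteq> 0")
      case True
      then have "0 < x $ k" by (auto simp: mem_box_cart less_le dest: spec[of _ k])
      then have "(x $ k powr (d - 1)) powr p * (x $ k) powr ((p - 1) * (1 - d)) = (x $ k) powr (d - 1)"
        by (simp add: powr_powr algebra_simps flip: powr_add)
      with \<open>0 < x $ k\<close> True show ?thesis
        by (simp add: f_def w_def coord_weight_def pow_weight_def epowr_ennreal flip: ennreal_mult)
    next
      case False
      then show ?thesis by (auto simp: f_def)
    qed
    then show ?thesis
      using mult_divide_eq_ennreal[of 1] by (simp add: avg_def nn_integral_completion Q)
  qed
  also have "\<dots> = avg {0..1} (\<lambda>t. ennreal (\<bar>t\<bar> powr (d - 1)))"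
    using avg_cbox_coord[of "\<lambda>t. ennreal (\<bar>t\<bar> powr (d - 1))" 0 "1::real^'n" k] by simp
  also have "\<dots> = ennreal (1 / d)"
    using d avg_Icc_0_powr[of d 1] by simp
  finally have norm: "lpw_norm p w (\<lambda>x. ennreal \<bar>f x\<bar>) = ennreal ((1 / d) powr (1 / p))"
    using d by (simp add: lpw_norm_def epowr_ennreal)
  show "f \<in> Lpw p w" by (simp add: Lpw_def norm)
  show "lpw_norm p w (\<lambda>x. ennreal \<bar>f x\<bar>) \<noteq> 0"
    using d by (simp add: norm)
  have "ennreal (1 / d) * ennreal \<bar>f x\<bar> \<le> strong_maximal f x" for x
  proof (cases "x \<in> cbox 0 1 \<and> x $ k \<noteq> 0")
    case True
    then have x: "0 < x $ k" "x $ k \<le> 1" "x \<in> cbox 0 1"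
      by (auto simp: mem_box_cart less_le dest: spec[of _ k])
    \<comment> \<open>The box \<open>cbox 0 u\<close> stays in the cube and ends at \<open>x\<close>
      in direction \<open>k\<close>; its full sides elsewhere let it contain
      \<open>x\<close>.\<close>
    define u :: "real^'n" where "u = (\<chi> j. if j = k then x $ k else 1)"
    have u: "0 $ i < u $ i" for i using x by (simp add: u_def)
    have sub: "cbox 0 u \<subseteq> cbox 0 1"
    proof -
      have "u $ i \<le> 1" for i using x by (simp add: u_def)
      then show ?thesis
        unfolding subset_iff mem_box_cart by (metis one_index order_trans)
    qed
    have xu: "x \<in> cbox 0 u" using x by (auto simp: mem_box_cart u_def)
    have "avg (cbox 0 u) (\<lambda>y. ennreal \<bar>f y\<bar>) = avg (cbox 0 u) (\<lambda>y. ennreal (\<bar>y $ k\<bar> powr (d - 1)))"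
      unfolding avg_def
    proof (intro arg_cong2[where f="(/)"] refl nn_integral_cong)
      fix y :: "real^'n"
      show "ennreal \<bar>f y\<bar> * indicator (cbox 0 u) y = ennreal (\<bar>y $ k\<bar> powr (d - 1)) * indicator (cbox 0 u) y"
      proof (cases "y \<in> cbox 0 u")
        case True
        then have "y \<in> cbox 0 1" using sub by blast
        moreover have "0 \<le> y $ k" using True by (simp add: mem_box_cart)
        ultimately show ?thesis by (simp add: f_def)
      qed simp
    qed
    also have "\<dots> = avg {0 $ k..u $ k} (\<lambda>t. ennreal (\<bar>t\<bar> powr (d - 1)))"
      by (rule avg_cbox_coord[OF _ u]) measurable
    also have "\<dots> = ennreal ((x $ k) powr (d - 1) / d)"
      using avg_Icc_0_powr[OF d(1) x(1)] by (simp add: u_def)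
    also have "\<dots> = ennreal (1 / d) * ennreal \<bar>f x\<bar>"
      using x d by (simp add: f_def flip: ennreal_mult)
    finally have "ennreal (1 / d) * ennreal \<bar>f x\<bar> \<le> avg (cbox 0 u) (\<lambda>y. ennreal \<bar>f y\<bar>)"
      by simp
    moreover have "box 0 u \<noteq> {}" using u by (auto simp: interval_eq_empty_cart not_le)
    then have "cbox 0 u \<in> parallelepipeds" unfolding parallelepipeds_def by blast
    ultimately show ?thesis
      unfolding strong_maximal_def using xu by (intro SUP_upper2[of "cbox 0 u"]) auto
  next
    case False
    then show ?thesis by (auto simp: f_def)
  qed
  then have "lpw_norm p w (\<lambda>x. ennreal (1 / d) * ennreal \<bar>f x\<bar>) \<le> lpw_norm p w (strong_maximal f)"
    using p by (intro lpw_norm_mono) auto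
  then show "ennreal (1 / d) * lpw_norm p w (\<lambda>x. ennreal \<bar>f x\<bar>) \<le> lpw_norm p w (strong_maximal f)"
    using p by (subst (asm) lpw_norm_cmult) auto
qed

text \<open>For the power weights the operator norm is at least \<open>1 / d\<close>, while the
  characteristic is at most \<open>T = (4 / d)^(p-1)\<close>. Monotonicity of \<open>\<psi>\<close>
  replaces the characteristic by this explicit bound, and \<open>\<psi> T\<close> is of smaller
  order than \<open>T^(1/(p-1)) = 4 / d\<close>.\<close>

lemma no_smaller_power:
  fixes \<psi> :: "real \<Rightarrow> real"
  assumes p: "1 < p" and mono: "mono_on {1..} \<psi>"
    and lim: "((\<lambda>t. \<psi> t / t powr (1 / (p - 1))) \<longlongrightarrow> 0) at_top"
    and bound: "\<forall>w \<in> (Ap_strong p :: (real^'n::finite \<Rightarrow> real) set). \<forall>f \<in> Lpw p w.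
      lpw_norm p w (strong_maximal f)
        \<le> ennreal (\<psi> (enn2real (Ap_char_prod p w))) * lpw_norm p w (\<lambda>x. ennreal \<bar>f x\<bar>)"
  shows False
proof -
  \<comment> \<open>The ratio 1/4 cancels the 4 in \<open>4 / d\<close>, giving
    \<open>\<psi> T < 1 / d\<close>.\<close>
  have ev: "eventually (\<lambda>t. \<psi> t / t powr (1 / (p - 1)) < 1 / 4) at_top"
    using lim by (rule order_tendstoD) simp
  have "filterlim (\<lambda>d::real. (4 / d) powr (p - 1)) at_top (at_right 0)"
    using p by real_asymp
  then have "eventually (\<lambda>d. \<psi> ((4 / d) powr (p - 1)) / ((4 / d) powr (p - 1)) powr (1 / (p - 1)) < 1 / 4) (at_right 0)"
    using ev by (rule eventually_compose_filterlim[rotated])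
  moreover have "filterlim (\<lambda>d::real. (1 / d) powr (p - 1) / p) at_top (at_right 0)"
    using p by real_asymp
  then have "eventually (\<lambda>d. 1 \<le> (1 / d) powr (p - 1) / p) (at_right 0)"
    by (simp add: filterlim_at_top)
  moreover have "eventually (\<lambda>d::real. 0 < d \<and> d < 1) (at_right 0)"
    by (auto simp: eventually_at_right[of 0 1] intro!: exI[of _ 1])
  ultimately have "eventually (\<lambda>d. False) (at_right (0::real))"
  proof eventually_elim
    case (elim d)
    then have d: "0 < d" "d < 1" by auto
    fix k :: 'n
    define \<alpha> where "\<alpha> = (p - 1) * (1 - d)"
    define w where "w = (coord_weight k \<alpha> :: real^'n \<Rightarrow> real)"
    obtain f where f: "f \<in> Lpw p w" "lpw_norm p w (\<lambda>x. ennreal \<bar>f x\<bar>) \<noteq> 0"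
      "ennreal (1 / d) * lpw_norm p w (\<lambda>x. ennreal \<bar>f x\<bar>) \<le> lpw_norm p w (strong_maximal f)"
      using strong_maximal_extremizer[OF p d, of k] unfolding w_def \<alpha>_def by blast
    define A where "A = enn2real (Ap_char_prod p w)"
    define T where "T = (4 / d) powr (p - 1)"
    have Ap_le: "Ap_const p (pow_weight \<alpha>) \<le> ennreal T"
      unfolding \<alpha>_def T_def by (rule Ap_const_pow_weight_le[OF p d])
    \<comment> \<open>Finiteness matters here: \<open>enn2real\<close> would send an infinite
      characteristic to 0.\<close>
    have A: "ennreal A = Ap_const p (pow_weight \<alpha>)"
      using Ap_le unfolding A_def w_def Ap_char_prod_coord_weight[OF p]
      by (intro ennreal_enn2real) (auto intro: le_less_trans)
    have "ennreal 1 \<le> ennreal ((1 / d) powr (p - 1) / p)"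
      using elim by (intro ennreal_leI) auto
    also have "\<dots> \<le> ennreal A"
      unfolding A \<alpha>_def by (rule Ap_const_pow_weight_ge[OF p d])
    finally have A1: "1 \<le> A" by (simp add: A_def)
    have AT: "A \<le> T" using Ap_le unfolding A[symmetric] by (simp add: T_def)
    have "w \<in> Ap_strong p"
      using p d Ap_const_coord_weight_le[of p k \<alpha>] Ap_le
      by (auto simp: Ap_strong_def w_def \<alpha>_def less_top[symmetric] top_unique intro: weight_coord_weight)
    then have "ennreal (1 / d) * lpw_norm p w (\<lambda>x. ennreal \<bar>f x\<bar>) \<le> ennreal (\<psi> A) * lpw_norm p w (\<lambda>x. ennreal \<bar>f x\<bar>)"
      unfolding A_def using bound f by (intro order_trans[OF f(3)]) blast
    moreover have "lpw_norm p w (\<lambda>x. ennreal \<bar>f x\<bar>) < top"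
      using f(1) by (simp add: Lpw_def)
    ultimately have "ennreal (1 / d) \<le> ennreal (\<psi> A)"
      using f(2) ennreal_mult_le_mult_iff[of "lpw_norm p w (\<lambda>x. ennreal \<bar>f x\<bar>)"]
      by (simp add: mult.commute[of _ "lpw_norm p w (\<lambda>x. ennreal \<bar>f x\<bar>)"] less_top)
    then have "1 / d \<le> \<psi> A"
      using d by (cases "0 \<le> \<psi> A") (auto simp: ennreal_neg)
    also have "\<dots> \<le> \<psi> T"
      using A1 AT by (intro mono_onD[OF mono]) auto
    also have "\<psi> T < 1 / d"
      using elim d p by (simp add: T_def powr_powr divide_simps)
    finally show False by simp
  qed
  then show False by (simp add: trivial_limit_at_right_real)
qed

theorem theorem4p5:
  fixes p :: real
  assumes "1 < p"
  shows "(\<exists>c::real. 0 < c \<and>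
            (\<forall>w \<in> (Ap_strong p :: (real^'n::finite \<Rightarrow> real) set). \<forall>f \<in> Lpw p w.
               lpw_norm p w (strong_maximal f)
                 \<le> ennreal c * epowr (Ap_char_prod p w) (1 / (p - 1))
                     * lpw_norm p w (\<lambda>x. ennreal \<bar>f x\<bar>)))
       \<and> \<not> (\<exists>\<psi>::real \<Rightarrow> real.
            (\<forall>t\<ge>1. 0 < \<psi> t) \<and> mono_on {1..} \<psi> \<and>
            ((\<lambda>t. \<psi> t / t powr (1 / (p - 1))) \<longlongrightarrow> 0) at_top \<and>
            (\<forall>w \<in> (Ap_strong p :: (real^'n::finite \<Rightarrow> real) set). \<forall>f \<in> Lpw p w.
               lpw_norm p w (strong_maximal f)
                 \<le> ennreal (\<psi> (enn2real (Ap_char_prod p w)))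
                     * lpw_norm p w (\<lambda>x. ennreal \<bar>f x\<bar>)))"
proof (rule conjI)
  let ?K = "maximal_const (conj_exp p) * maximal_const p"
  have "0 < ?K"
    using assms conj_exp_simps(1)[OF assms] by (simp add: maximal_const_def)
  moreover have "0 < 2 ^ CARD('n) * (K ^ CARD('n)) powr (1 / p)" if "0 < K" for K :: real
    using that by simp
  ultimately have "0 < 2 ^ CARD('n) * (?K ^ CARD('n)) powr (1 / p)" by blast
  then show "\<exists>c::real. 0 < c \<and>
      (\<forall>w \<in> (Ap_strong p :: (real^'n::finite \<Rightarrow> real) set). \<forall>f \<in> Lpw p w.
         lpw_norm p w (strong_maximal f)
           \<le> ennreal c * epowr (Ap_char_prod p w) (1 / (p - 1)) * lpw_norm p w (\<lambda>x. ennreal \<bar>f x\<bar>))"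
    using strong_maximal_bound[OF assms] unfolding Ap_strong_def Lpw_def by blast
qed (use no_smaller_power[OF assms] in blast)


end
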